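(* If the OuMv conjecture is true, there is no algorithm solving the $\#s$-$\triangle$ problem with $O(n)$-delayed predictions with update time $U(n)$ and query time $Q(n)$ satisfying $n^2U(n)+nQ(n)=\tilde{\tilde o}(n^3)$.
   Context: The $\#s$-$\triangle$ problem: a dynamic undirected graph on $n$ vertices with fixed vertex $s$; each update flips an edge (insert if absent, delete if present); each query asks for the number of triangles containing $s$. Requests arrive online; queries are answered before the next request. A permutation $\pi$ of $[T]$ acts by $\pi(\rho)=(\rho_{\pi(1)},\ldots,\rho_{\pi(T)})$ and is $d$-close to the identity if $|\pi^{-1}(t)-t|\le d$ for all $t$; a predicted sequence $\hat\rho$ is $d$-delayed for a set $\mathcal S$ of request sequences if every $\rho\in\mathcal S$ admits such a $\pi$ with $\pi(\rho)=\hat\rho$; an algorithm with $d$-delayed predictions receives $\hat\rho$ in polynomial-time preprocessing and must be correct on every sequence for which $\hat\rho$ is $d$-delayed. OuMv conjecture: for any constant $\varepsilon>0$, no algorithm for OuMv ($n\times n$ Boolean matrix $M$ preprocessed in polynomial time, then $n$ online pairs $(\vec u_t,\vec v_t)$, report Boolean $\vec u_t^\top M\vec v_t$ before next pair) runs in total time $O(n^{3-\varepsilon})$ with error probability $\le1/3$. $f(n)=\tilde{\tilde o}(n^c)$ means $f(n)\le Cn^{c-\varepsilon}$ for constants $C,\varepsilon>0$ and all large $n$. *)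

theory Defs
  imports
    "HOL-Probability.Probability"
    "HOL-Combinatorics.Permutations"
    "HOL-Library.Landau_Symbols"
begin

text \<open>
  Model of computation: a randomized word RAM, presented as a structured programming language
  with finitely many named registers and finitely many named arrays per program, unit cost per
  executed instruction, and an instruction drawing a fair random bit. The parameter \<open>W\<close> of the
  semantics is the largest number that fits into a machine word: an instruction whose result
  exceeds \<open>W\<close> has no execution, so algorithms, which are required to terminate on every input
  and every sequence of random bits, must not overflow. Below, \<open>W\<close> is polynomial in the input
  size, i.e. words have logarithmically many bits.
\<close>

type_synonym name = string

record store =
  reg :: "name \<Rightarrow> nat"
  arr :: "name \<Rightarrow> nat \<Rightarrow> nat"
  coins :: "bool stream"

datatype binop = Add | Sub | Mul | Div | Mod | BitAnd | BitOr | BitXor | ShiftL | ShiftR | Eq | Less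

fun binop_val :: "binop \<Rightarrow> nat \<Rightarrow> nat \<Rightarrow> nat" where
  "binop_val Add a b = a + b"
| "binop_val Sub a b = a - b"
| "binop_val Mul a b = a * b"
| "binop_val Div a b = a div b"
| "binop_val Mod a b = a mod b"
| "binop_val BitAnd a b = semiring_bit_operations_class.and a b"
| "binop_val BitOr a b = semiring_bit_operations_class.or a b"
| "binop_val BitXor a b = semiring_bit_operations_class.xor a b"
| "binop_val ShiftL a b = push_bit b a"
| "binop_val ShiftR a b = drop_bit b a"
| "binop_val Eq a b = of_bool (a = b)"
| "binop_val Less a b = of_bool (a < b)"

datatype com =
    Skip
  | Const name nat
  | Bin name binop name name
  | Load name name name       \<comment> \<open>\<open>Load x a i\<close> is \<open>x := a[i]\<close>\<close>
  | Store name name name      \<comment> \<open>\<open>Store a i x\<close> is \<open>a[i] := x\<close>\<close>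
  | Toss name
  | Seq com com
  | If name com com
  | While name com

text \<open>\<open>exec W c \<sigma> t \<sigma>'\<close>: started in \<open>\<sigma>\<close>, the program \<open>c\<close> halts in \<open>\<sigma>'\<close> after exactly \<open>t\<close> steps.\<close>

inductive exec :: "nat \<Rightarrow> com \<Rightarrow> store \<Rightarrow> nat \<Rightarrow> store \<Rightarrow> bool" for W :: nat where
  Skip: "exec W Skip \<sigma> 1 \<sigma>"
| Const: "k \<le> W \<Longrightarrow> exec W (Const x k) \<sigma> 1 (\<sigma>\<lparr>reg := (reg \<sigma>)(x := k)\<rparr>)"
| Bin: "r = binop_val f (reg \<sigma> y) (reg \<sigma> z) \<Longrightarrow> r \<le> W \<Longrightarrow>
    exec W (Bin x f y z) \<sigma> 1 (\<sigma>\<lparr>reg := (reg \<sigma>)(x := r)\<rparr>)"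
| Load: "exec W (Load x a i) \<sigma> 1 (\<sigma>\<lparr>reg := (reg \<sigma>)(x := arr \<sigma> a (reg \<sigma> i))\<rparr>)"
| Store: "exec W (Store a i x) \<sigma> 1
    (\<sigma>\<lparr>arr := (arr \<sigma>)(a := (arr \<sigma> a)(reg \<sigma> i := reg \<sigma> x))\<rparr>)"
| Toss: "exec W (Toss x) \<sigma> 1
    (\<sigma>\<lparr>reg := (reg \<sigma>)(x := of_bool (shd (coins \<sigma>))), coins := stl (coins \<sigma>)\<rparr>)"
| Seq: "exec W c \<sigma> t \<sigma>' \<Longrightarrow> exec W d \<sigma>' t' \<sigma>'' \<Longrightarrow> exec W (Seq c d) \<sigma> (t + t') \<sigma>''"
| IfTrue: "reg \<sigma> x \<noteq> 0 \<Longrightarrow> exec W c \<sigma> t \<sigma>' \<Longrightarrow> exec W (If x c d) \<sigma> (1 + t) \<sigma>'"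
| IfFalse: "reg \<sigma> x = 0 \<Longrightarrow> exec W d \<sigma> t \<sigma>' \<Longrightarrow> exec W (If x c d) \<sigma> (1 + t) \<sigma>'"
| WhileFalse: "reg \<sigma> x = 0 \<Longrightarrow> exec W (While x c) \<sigma> 1 \<sigma>"
| WhileTrue: "reg \<sigma> x \<noteq> 0 \<Longrightarrow> exec W c \<sigma> t \<sigma>' \<Longrightarrow> exec W (While x c) \<sigma>' t' \<sigma>'' \<Longrightarrow>
    exec W (While x c) \<sigma> (1 + t + t') \<sigma>''"

definition fair_coins :: "bool stream measure" where
  "fair_coins = stream_space (measure_pmf (bernoulli_pmf (1/2)))"

definition zero_store :: "bool stream \<Rightarrow> store" where
  "zero_store \<omega> = \<lparr>reg = (\<lambda>_. 0), arr = (\<lambda>_ _. 0), coins = \<omega>\<rparr>"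

definition strictly_below_power :: "(nat \<Rightarrow> real) \<Rightarrow> real \<Rightarrow> bool" where
  "strictly_below_power f c \<longleftrightarrow>
     (\<exists>C>0. \<exists>\<epsilon>>0. \<forall>\<^sub>F n in sequentially. f n \<le> C * real n powr (c - \<epsilon>))"

type_synonym bool_vec = "nat \<Rightarrow> bool"
type_synonym bool_mat = "nat \<Rightarrow> nat \<Rightarrow> bool"

definition uMv :: "nat \<Rightarrow> bool_mat \<Rightarrow> bool_vec \<Rightarrow> bool_vec \<Rightarrow> bool" where
  "uMv n M u v \<longleftrightarrow> (\<exists>i<n. \<exists>j<n. u i \<and> M i j \<and> v j)"

record oumv_alg =
  oumv_prep :: com
  oumv_round :: com

definition vec_array :: "nat \<Rightarrow> bool_vec \<Rightarrow> nat \<Rightarrow> nat" where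
  "vec_array n u = (\<lambda>i. if i < n then of_bool (u i) else 0)"

definition mat_array :: "nat \<Rightarrow> bool_mat \<Rightarrow> nat \<Rightarrow> nat" where
  "mat_array n M = (\<lambda>a. if a < n * n then of_bool (M (a div n) (a mod n)) else 0)"

definition oumv_init :: "nat \<Rightarrow> bool_mat \<Rightarrow> bool stream \<Rightarrow> store" where
  "oumv_init n M \<omega> = (zero_store \<omega>)
     \<lparr>reg := (\<lambda>_. 0)(''n'' := n), arr := (\<lambda>_ _. 0)(''M'' := mat_array n M)\<rparr>"

definition oumv_input :: "nat \<Rightarrow> bool_vec \<Rightarrow> bool_vec \<Rightarrow> store \<Rightarrow> store" where
  "oumv_input n u v \<sigma> =
     \<sigma>\<lparr>arr := (arr \<sigma>)(''u'' := vec_array n u, ''v'' := vec_array n v)\<rparr>"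

text \<open>
  \<open>oumv_rounds A W n \<sigma> uvs t as\<close>: from \<open>\<sigma>\<close>, the pairs \<open>uvs\<close> are served in order, in total time \<open>t\<close>,
  with reported answers \<open>as\<close>. A pair enters the store only after the answer to the previous pair
  has been read off.
\<close>

inductive oumv_rounds ::
  "oumv_alg \<Rightarrow> nat \<Rightarrow> nat \<Rightarrow> store \<Rightarrow> (bool_vec \<times> bool_vec) list \<Rightarrow> nat \<Rightarrow> nat list \<Rightarrow> bool"
  for A :: oumv_alg and W n :: nat where
  Nil: "oumv_rounds A W n \<sigma> [] 0 []"
| Cons: "exec W (oumv_round A) (oumv_input n u v \<sigma>) t \<sigma>' \<Longrightarrow> oumv_rounds A W n \<sigma>' uvs t' as \<Longrightarrow>
    oumv_rounds A W n \<sigma> ((u, v) # uvs) (t + t') (reg \<sigma>' ''answer'' # as)"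

definition oumv_run ::
  "oumv_alg \<Rightarrow> nat \<Rightarrow> nat \<Rightarrow> bool_mat \<Rightarrow> (bool_vec \<times> bool_vec) list \<Rightarrow> bool stream \<Rightarrow>
   nat \<Rightarrow> nat \<Rightarrow> nat list \<Rightarrow> bool" where
  "oumv_run A W n M uvs \<omega> p t as \<longleftrightarrow>
     (\<exists>\<sigma>. exec W (oumv_prep A) (oumv_init n M \<omega>) p \<sigma> \<and> oumv_rounds A W n \<sigma> uvs t as)"

text \<open>
  Error probability at most \<open>1/3\<close> is expressed as success probability at least \<open>2/3\<close>, because
  \<^const>\<open>measure\<close> is \<open>0\<close> on non-measurable sets. \<open>T\<close> bounds the total time of the online rounds.
\<close>

definition solves_oumv :: "oumv_alg \<Rightarrow> (nat \<Rightarrow> real) \<Rightarrow> bool" where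
  "solves_oumv A T \<longleftrightarrow>
     (\<exists>k. \<forall>n\<ge>1. \<forall>M uvs. length uvs = n \<longrightarrow>
        (\<forall>\<omega>. \<exists>p t as. oumv_run A ((n + 2) ^ k) n M uvs \<omega> p t as \<and>
               p \<le> (n + 2) ^ k \<and> real t \<le> T n) \<and>
        measure fair_coins
          {\<omega>. \<exists>p t. oumv_run A ((n + 2) ^ k) n M uvs \<omega> p t
                   (map (\<lambda>(u, v). of_bool (uMv n M u v)) uvs)} \<ge> 2 / 3)"

definition OuMv_conjecture :: bool where
  "OuMv_conjecture \<longleftrightarrow>
     (\<forall>\<epsilon>::real. \<epsilon> > 0 \<longrightarrow>
        \<not> (\<exists>A T. solves_oumv A T \<and> T \<in> O(\<lambda>n. real n powr (3 - \<epsilon>))))"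

text \<open>
  Vertices are \<open>0, \<dots>, n - 1\<close>. The undirected edge \<open>{u, v}\<close> is presented to algorithms
  as \<open>Update u v\<close> with \<open>u < v\<close>.
\<close>

datatype request = Update nat nat | Query

type_synonym graph = "nat set set"

definition valid_request :: "nat \<Rightarrow> request \<Rightarrow> bool" where
  "valid_request n r \<longleftrightarrow> (case r of Update u v \<Rightarrow> u < v \<and> v < n | Query \<Rightarrow> True)"

definition flip_edge :: "nat set \<Rightarrow> graph \<Rightarrow> graph" where
  "flip_edge e G = (if e \<in> G then G - {e} else insert e G)"

definition triangles_at :: "nat \<Rightarrow> nat \<Rightarrow> graph \<Rightarrow> nat set set" where
  "triangles_at n s G =
     {S. S \<subseteq> {..<n} \<and> card S = 3 \<and> s \<in> S \<and> (\<forall>x\<in>S. \<forall>y\<in>S. x \<noteq> y \<longrightarrow> {x, y} \<in> G)}"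

fun correct_answers :: "nat \<Rightarrow> nat \<Rightarrow> graph \<Rightarrow> request list \<Rightarrow> nat list" where
  "correct_answers n s G [] = []"
| "correct_answers n s G (Update u v # \<rho>) = correct_answers n s (flip_edge {u, v} G) \<rho>"
| "correct_answers n s G (Query # \<rho>) = card (triangles_at n s G) # correct_answers n s G \<rho>"

text \<open>Positions are numbered from \<open>0\<close>; \<open>permute_list \<pi> \<rho>\<close> is the action \<open>\<pi>(\<rho>)\<close>.\<close>

definition close_to_id :: "nat \<Rightarrow> nat \<Rightarrow> (nat \<Rightarrow> nat) \<Rightarrow> bool" where
  "close_to_id d T \<pi> \<longleftrightarrow> \<pi> permutes {..<T} \<and> (\<forall>t<T. \<bar>int (inv \<pi> t) - int t\<bar> \<le> int d)"

definition delayed_for :: "nat \<Rightarrow> request list \<Rightarrow> request list set \<Rightarrow> bool" where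
  "delayed_for d \<rho>' S \<longleftrightarrow> (\<forall>\<rho>\<in>S. \<exists>\<pi>. close_to_id d (length \<rho>) \<pi> \<and> permute_list \<pi> \<rho> = \<rho>')"

record dyn_alg =
  dyn_prep :: com
  dyn_update :: com
  dyn_query :: com

definition request_array :: "(request \<Rightarrow> nat) \<Rightarrow> request list \<Rightarrow> nat \<Rightarrow> nat" where
  "request_array f \<rho> = (\<lambda>i. if i < length \<rho> then f (\<rho> ! i) else 0)"

text \<open>
  The predicted sequence is laid out in three arrays; \<open>''kind''\<close> is \<open>1\<close> for updates and \<open>0\<close> for
  queries, \<open>''fst''\<close> and \<open>''snd''\<close> hold the endpoints of updates.
\<close>

definition dyn_init :: "nat \<Rightarrow> nat \<Rightarrow> request list \<Rightarrow> bool stream \<Rightarrow> store" where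
  "dyn_init n s \<rho>' \<omega> = (zero_store \<omega>)
     \<lparr>reg := (\<lambda>_. 0)(''n'' := n, ''s'' := s, ''T'' := length \<rho>'),
      arr := (\<lambda>_ _. 0)
        (''kind'' := request_array (\<lambda>r. case r of Update u v \<Rightarrow> 1 | Query \<Rightarrow> 0) \<rho>',
         ''fst'' := request_array (\<lambda>r. case r of Update u v \<Rightarrow> u | Query \<Rightarrow> 0) \<rho>',
         ''snd'' := request_array (\<lambda>r. case r of Update u v \<Rightarrow> v | Query \<Rightarrow> 0) \<rho>')\<rparr>"

definition update_input :: "nat \<Rightarrow> nat \<Rightarrow> store \<Rightarrow> store" where
  "update_input u v \<sigma> = \<sigma>\<lparr>reg := (reg \<sigma>)(''u'' := u, ''v'' := v)\<rparr>"

text \<open>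
  \<open>dyn_serve A W \<sigma> \<rho> ts as\<close>: from \<open>\<sigma>\<close>, the requests \<open>\<rho>\<close> are served in order; \<open>ts\<close> lists the time
  spent on each request and \<open>as\<close> the answers to the queries.
\<close>

inductive dyn_serve ::
  "dyn_alg \<Rightarrow> nat \<Rightarrow> store \<Rightarrow> request list \<Rightarrow> nat list \<Rightarrow> nat list \<Rightarrow> bool"
  for A :: dyn_alg and W :: nat where
  Nil: "dyn_serve A W \<sigma> [] [] []"
| Update: "exec W (dyn_update A) (update_input u v \<sigma>) t \<sigma>' \<Longrightarrow> dyn_serve A W \<sigma>' \<rho> ts as \<Longrightarrow>
    dyn_serve A W \<sigma> (Update u v # \<rho>) (t # ts) as"
| Query: "exec W (dyn_query A) \<sigma> t \<sigma>' \<Longrightarrow> dyn_serve A W \<sigma>' \<rho> ts as \<Longrightarrow>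
    dyn_serve A W \<sigma> (Query # \<rho>) (t # ts) (reg \<sigma>' ''answer'' # as)"

definition dyn_run ::
  "dyn_alg \<Rightarrow> nat \<Rightarrow> nat \<Rightarrow> nat \<Rightarrow> request list \<Rightarrow> request list \<Rightarrow> bool stream \<Rightarrow>
   nat \<Rightarrow> nat list \<Rightarrow> nat list \<Rightarrow> bool" where
  "dyn_run A W n s \<rho>' \<rho> \<omega> p ts as \<longleftrightarrow>
     (\<exists>\<sigma>. exec W (dyn_prep A) (dyn_init n s \<rho>' \<omega>) p \<sigma> \<and> dyn_serve A W \<sigma> \<rho> ts as)"

definition request_time :: "real \<Rightarrow> real \<Rightarrow> request \<Rightarrow> real" where
  "request_time U Q r = (case r of Update u v \<Rightarrow> U | Query \<Rightarrow> Q)"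

text \<open>
  The graph is initially empty. The input of the preprocessing has size \<open>n + length \<rho>'\<close>, up to a
  constant factor.
\<close>

definition solves_s_triangle_delayed ::
  "dyn_alg \<Rightarrow> (nat \<Rightarrow> nat) \<Rightarrow> (nat \<Rightarrow> real) \<Rightarrow> (nat \<Rightarrow> real) \<Rightarrow> bool" where
  "solves_s_triangle_delayed A d U Q \<longleftrightarrow>
     (\<exists>k. \<forall>n s \<rho>' \<rho>. s < n \<longrightarrow> (\<forall>r\<in>set \<rho>'. valid_request n r) \<longrightarrow> delayed_for (d n) \<rho>' {\<rho>} \<longrightarrow>
        (let W = (n + length \<rho>' + 2) ^ k in
          (\<forall>\<omega>. \<exists>p ts as. dyn_run A W n s \<rho>' \<rho> \<omega> p ts as \<and> p \<le> (n + length \<rho>' + 2) ^ k \<and>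
                 (\<forall>i<length \<rho>. real (ts ! i) \<le> request_time (U n) (Q n) (\<rho> ! i))) \<and>
          measure fair_coins
            {\<omega>. \<exists>p ts. dyn_run A W n s \<rho>' \<rho> \<omega> p ts (correct_answers n s {} \<rho>)} \<ge> 2 / 3))"

end

theory Submission
  imports Defs "HOL-Real_Asymp.Real_Asymp"
begin

text \<open>
  A Boolean \<open>n \<times> n\<close> matrix is stored as a bipartite graph between the rows \<open>0, \<dots>, n - 1\<close> and the
  columns \<open>n, \<dots>, 2n - 1\<close>; the source \<open>s = 3n\<close> is joined to the rows in \<open>u\<close> and the columns in \<open>v\<close>,
  so that triangles at \<open>s\<close> are the witnesses of \<open>u\<^sup>T M v\<close>. The prediction for a round is
  "flip all \<open>2n\<close> edges at \<open>s\<close>, query, flip them all again", which does not depend on \<open>(u, v)\<close>. The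
  real round flips only the selected edges before the query, the remaining ones directly after it,
  and then all of them once more: this is the same multiset of requests, moved by at most \<open>4n\<close>
  positions, and it restores the graph. A zero entry of the matrix is recorded as an edge to one of the
  dummy vertices \<open>2n, \<dots>, 3n - 1\<close>, which are never joined to \<open>s\<close>; hence the length of the
  prediction depends on \<open>n\<close> only.

  The OuMv algorithm runs the given dynamic algorithm with all its registers and arrays renamed
  apart. Its success event contains that of the dynamic algorithm, and it is measurable because
  every terminating run reads only finitely many coins.
\<close>

notation Seq (infixr ";;" 60)

inductive_simps exec_simps:
  "exec W Skip \<sigma> t \<sigma>'"
  "exec W (Const x k) \<sigma> t \<sigma>'"
  "exec W (Bin x f y z) \<sigma> t \<sigma>'"
  "exec W (Load x a i) \<sigma> t \<sigma>'"
  "exec W (Store a i x) \<sigma> t \<sigma>'"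
  "exec W (Toss x) \<sigma> t \<sigma>'"
  "exec W (c ;; d) \<sigma> t \<sigma>'"
  "exec W (If x c d) \<sigma> t \<sigma>'"

subsection \<open>Renaming of programs\<close>

primrec rename :: "(name \<Rightarrow> name) \<Rightarrow> com \<Rightarrow> com" where
  "rename f Skip = Skip"
| "rename f (Const x k) = Const (f x) k"
| "rename f (Bin x g y z) = Bin (f x) g (f y) (f z)"
| "rename f (Load x a i) = Load (f x) (f a) (f i)"
| "rename f (Store a i x) = Store (f a) (f i) (f x)"
| "rename f (Toss x) = Toss (f x)"
| "rename f (c ;; d) = rename f c ;; rename f d"
| "rename f (If x c d) = If (f x) (rename f c) (rename f d)"
| "rename f (While x c) = While (f x) (rename f c)"

definition restrict_store :: "(name \<Rightarrow> name) \<Rightarrow> store \<Rightarrow> store" where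
  "restrict_store f \<tau> = \<lparr>reg = reg \<tau> \<circ> f, arr = arr \<tau> \<circ> f, coins = coins \<tau>\<rparr>"

definition embed_store :: "(name \<Rightarrow> name) \<Rightarrow> store \<Rightarrow> store \<Rightarrow> store" where
  "embed_store f \<tau> \<sigma> =
    \<lparr>reg = (\<lambda>x. if x \<in> range f then reg \<sigma> (inv f x) else reg \<tau> x),
     arr = (\<lambda>x. if x \<in> range f then arr \<sigma> (inv f x) else arr \<tau> x), coins = coins \<sigma>\<rparr>"

lemma embed_store_simps:
  assumes "inj f"
  shows "reg (embed_store f \<tau> \<sigma>) (f x) = reg \<sigma> x" "arr (embed_store f \<tau> \<sigma>) (f x) = arr \<sigma> x"
    "coins (embed_store f \<tau> \<sigma>) = coins \<sigma>"
    "embed_store f \<tau> (\<sigma>\<lparr>reg := (reg \<sigma>)(x := k)\<rparr>) =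
      (embed_store f \<tau> \<sigma>)\<lparr>reg := (reg (embed_store f \<tau> \<sigma>))(f x := k)\<rparr>"
    "embed_store f \<tau> (\<sigma>\<lparr>arr := (arr \<sigma>)(x := g)\<rparr>) =
      (embed_store f \<tau> \<sigma>)\<lparr>arr := (arr (embed_store f \<tau> \<sigma>))(f x := g)\<rparr>"
    "embed_store f \<tau> (\<sigma>\<lparr>coins := \<omega>\<rparr>) = (embed_store f \<tau> \<sigma>)\<lparr>coins := \<omega>\<rparr>"
  using assms by (auto simp: embed_store_def fun_eq_iff inj_eq)

lemma restrict_embed_store: "inj f \<Longrightarrow> restrict_store f (embed_store f \<tau> \<sigma>) = \<sigma>"
  by (simp add: restrict_store_def embed_store_def comp_def)

lemma embed_restrict_store: "inj f \<Longrightarrow> embed_store f \<tau> (restrict_store f \<tau>) = \<tau>"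
  by (auto simp: restrict_store_def embed_store_def fun_eq_iff intro!: store.equality)

lemma exec_rename:
  assumes "exec W c \<sigma> t \<sigma>'" "inj f" "W \<le> W'"
  shows "exec W' (rename f c) (embed_store f \<tau> \<sigma>) t (embed_store f \<tau> \<sigma>')"
  using assms(1)
proof induction
  case (WhileFalse \<sigma> x c)
  then show ?case
    using assms(2) exec.WhileFalse[of "embed_store f \<tau> \<sigma>"] by (simp add: embed_store_simps)
next
  case (WhileTrue \<sigma> x c t \<sigma>' t' \<sigma>'')
  then show ?case
    using assms(2) exec.WhileTrue[OF _ WhileTrue.IH(1)] by (simp add: embed_store_simps)
qed (use assms(2,3) in \<open>auto simp: embed_store_simps exec_simps\<close>)

subsection \<open>Random bits\<close>

lemma exec_reads_prefix_of_coins: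
  assumes "exec W c \<sigma> t \<sigma>'"
  shows "\<exists>xs. coins \<sigma> = xs @- coins \<sigma>' \<and>
    (\<forall>\<omega>. exec W c (\<sigma>\<lparr>coins := xs @- \<omega>\<rparr>) t (\<sigma>'\<lparr>coins := \<omega>\<rparr>))"
  using assms
proof induction
  case (Toss x \<sigma>)
  show ?case by (rule exI[of _ "[shd (coins \<sigma>)]"]) (simp add: exec_simps)
next
  case (Seq c \<sigma> t \<sigma>' d t' \<sigma>'')
  then obtain xs ys where "coins \<sigma> = xs @- coins \<sigma>'"
      "\<And>\<omega>. exec W c (\<sigma>\<lparr>coins := xs @- \<omega>\<rparr>) t (\<sigma>'\<lparr>coins := \<omega>\<rparr>)"
    and "coins \<sigma>' = ys @- coins \<sigma>''"
      "\<And>\<omega>. exec W d (\<sigma>'\<lparr>coins := ys @- \<omega>\<rparr>) t' (\<sigma>''\<lparr>coins := \<omega>\<rparr>)"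
    by blast
  then show ?case by (intro exI[of _ "xs @ ys"]) (auto intro: exec.Seq)
next
  case (WhileFalse \<sigma> x c)
  then show ?case by (auto simp del: One_nat_def intro!: exI[of _ "[]"] exec.WhileFalse)
next
  case (WhileTrue \<sigma> x c t \<sigma>' t' \<sigma>'')
  then obtain xs ys where "coins \<sigma> = xs @- coins \<sigma>'"
      "\<And>\<omega>. exec W c (\<sigma>\<lparr>coins := xs @- \<omega>\<rparr>) t (\<sigma>'\<lparr>coins := \<omega>\<rparr>)"
    and "coins \<sigma>' = ys @- coins \<sigma>''"
      "\<And>\<omega>. exec W (While x c) (\<sigma>'\<lparr>coins := ys @- \<omega>\<rparr>) t' (\<sigma>''\<lparr>coins := \<omega>\<rparr>)"
    by blast
  with WhileTrue.hyps(1) show ?case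
    by (intro exI[of _ "xs @ ys"] conjI allI exec.WhileTrue) auto
qed (auto simp: exec_simps intro!: exI[of _ "[]"])

lemma oumv_rounds_read_prefix_of_coins:
  assumes "oumv_rounds A W n \<sigma> uvs t as"
  shows "\<exists>xs \<omega>\<^sub>0. coins \<sigma> = xs @- \<omega>\<^sub>0 \<and>
    (\<forall>\<omega>. oumv_rounds A W n (\<sigma>\<lparr>coins := xs @- \<omega>\<rparr>) uvs t as)"
  using assms
proof induction
  case (Nil \<sigma>)
  show ?case by (auto intro: oumv_rounds.Nil exI[of _ "[]"])
next
  case (Cons u v \<sigma> t \<sigma>' uvs t' as)
  have input: "oumv_input n u v (\<sigma>\<lparr>coins := \<omega>\<rparr>) = (oumv_input n u v \<sigma>)\<lparr>coins := \<omega>\<rparr>"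
    "coins (oumv_input n u v \<sigma>) = coins \<sigma>" for \<omega>
    by (simp_all add: oumv_input_def)
  obtain xs where first: "coins \<sigma> = xs @- coins \<sigma>'"
    "\<And>\<omega>. exec W (oumv_round A) (oumv_input n u v (\<sigma>\<lparr>coins := xs @- \<omega>\<rparr>)) t (\<sigma>'\<lparr>coins := \<omega>\<rparr>)"
    using exec_reads_prefix_of_coins[OF Cons.hyps(1)] by (auto simp: input)
  obtain ys \<omega>\<^sub>0 where rest: "coins \<sigma>' = ys @- \<omega>\<^sub>0"
    "\<And>\<omega>. oumv_rounds A W n (\<sigma>'\<lparr>coins := ys @- \<omega>\<rparr>) uvs t' as"
    using Cons.IH by blast
  have "oumv_rounds A W n (\<sigma>\<lparr>coins := (xs @ ys) @- \<omega>\<rparr>) ((u, v) # uvs) (t + t')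
    (reg \<sigma>' ''answer'' # as)" for \<omega>
    using oumv_rounds.Cons[OF first(2) rest(2)] by simp
  moreover have "coins \<sigma> = (xs @ ys) @- \<omega>\<^sub>0" using first(1) rest(1) by simp
  ultimately show ?case by blast
qed

lemma oumv_run_reads_prefix_of_coins:
  assumes "oumv_run A W n M uvs \<omega> p t as"
  shows "\<exists>xs \<omega>\<^sub>0. \<omega> = xs @- \<omega>\<^sub>0 \<and> (\<forall>\<omega>'. oumv_run A W n M uvs (xs @- \<omega>') p t as)"
proof -
  have init: "coins (oumv_init n M \<omega>) = \<omega>"
    "(oumv_init n M \<omega>)\<lparr>coins := \<omega>'\<rparr> = oumv_init n M \<omega>'" for \<omega>'
    by (simp_all add: oumv_init_def zero_store_def)
  obtain \<sigma> where run: "exec W (oumv_prep A) (oumv_init n M \<omega>) p \<sigma>" "oumv_rounds A W n \<sigma> uvs t as"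
    using assms by (auto simp: oumv_run_def)
  obtain xs where first: "\<omega> = xs @- coins \<sigma>"
    "\<And>\<omega>'. exec W (oumv_prep A) (oumv_init n M (xs @- \<omega>')) p (\<sigma>\<lparr>coins := \<omega>'\<rparr>)"
    using exec_reads_prefix_of_coins[OF run(1)] by (auto simp: init)
  obtain ys \<omega>\<^sub>0 where rest: "coins \<sigma> = ys @- \<omega>\<^sub>0"
    "\<And>\<omega>'. oumv_rounds A W n (\<sigma>\<lparr>coins := ys @- \<omega>'\<rparr>) uvs t as"
    using oumv_rounds_read_prefix_of_coins[OF run(2)] by blast
  have "oumv_run A W n M uvs ((xs @ ys) @- \<omega>') p t as" for \<omega>'
    using first(2)[of "ys @- \<omega>'"] rest(2)[of \<omega>'] by (auto simp: oumv_run_def)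
  moreover have "\<omega> = (xs @ ys) @- \<omega>\<^sub>0" using first(1) rest(1) by simp
  ultimately show ?thesis by blast
qed

lemma sets_fair_coins_cylinder: "{\<omega>. stake (length xs) \<omega> = xs} \<in> sets fair_coins"
proof -
  have "{\<omega>. stake (length xs) \<omega> = xs} \<in> sets (stream_space (count_space (UNIV :: bool set)))"
    using measurable_sets[OF measurable_stake, of "{xs}" "length xs"]
    by (simp add: space_stream_space vimage_def)
  also have "sets (stream_space (count_space UNIV)) = sets fair_coins"
    unfolding fair_coins_def by (rule sets_stream_space_cong) simp
  finally show ?thesis .
qed

lemma sets_fair_coins_if_determined_by_prefix:
  assumes "\<And>\<omega>. \<omega> \<in> S \<Longrightarrow> \<exists>xs \<omega>\<^sub>0. \<omega> = xs @- \<omega>\<^sub>0 \<and> (\<forall>\<omega>'. xs @- \<omega>' \<in> S)"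
  shows "S \<in> sets fair_coins"
proof -
  have "S = (\<Union>xs\<in>{xs. \<forall>\<omega>. xs @- \<omega> \<in> S}. {\<omega>. stake (length xs) \<omega> = xs})"
  proof (intro equalityI subsetI)
    fix \<omega> assume "\<omega> \<in> S"
    with assms show "\<omega> \<in> (\<Union>xs\<in>{xs. \<forall>\<omega>. xs @- \<omega> \<in> S}. {\<omega>. stake (length xs) \<omega> = xs})"
      by (fastforce simp: stake_shift)
  next
    fix \<omega> assume "\<omega> \<in> (\<Union>xs\<in>{xs. \<forall>\<omega>. xs @- \<omega> \<in> S}. {\<omega>. stake (length xs) \<omega> = xs})"
    then show "\<omega> \<in> S" by clarsimp (metis stake_sdrop)
  qed
  moreover have "(\<Union>xs\<in>{xs. \<forall>\<omega>. xs @- \<omega> \<in> S}. {\<omega>. stake (length xs) \<omega> = xs}) \<in> sets fair_coins"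
    by (rule sets.countable_UN') (auto simp: sets_fair_coins_cylinder)
  ultimately show ?thesis by simp
qed

lemma oumv_success_measurable: "{\<omega>. \<exists>p t. oumv_run A W n M uvs \<omega> p t as} \<in> sets fair_coins"
proof (rule sets_fair_coins_if_determined_by_prefix)
  fix \<omega> assume "\<omega> \<in> {\<omega>. \<exists>p t. oumv_run A W n M uvs \<omega> p t as}"
  then show "\<exists>xs \<omega>\<^sub>0. \<omega> = xs @- \<omega>\<^sub>0 \<and>
      (\<forall>\<omega>'. xs @- \<omega>' \<in> {\<omega>. \<exists>p t. oumv_run A W n M uvs \<omega> p t as})"
    using oumv_run_reads_prefix_of_coins by blast
qed

lemma prob_space_fair_coins: "prob_space fair_coins"
  unfolding fair_coins_def by (intro prob_space.prob_space_stream_space prob_space_measure_pmf)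

subsection \<open>Timed total correctness\<close>

definition wp :: "nat \<Rightarrow> com \<Rightarrow> (nat \<Rightarrow> store \<Rightarrow> bool) \<Rightarrow> nat \<Rightarrow> store \<Rightarrow> bool" where
  "wp W c Q t \<sigma> \<longleftrightarrow> (\<exists>d \<sigma>'. exec W c \<sigma> d \<sigma>' \<and> Q (t + d) \<sigma>')"

definition terminates_within :: "nat \<Rightarrow> com \<Rightarrow> real \<Rightarrow> (store \<Rightarrow> bool) \<Rightarrow> store \<Rightarrow> bool" where
  "terminates_within W c k Q \<sigma> \<longleftrightarrow> (\<exists>t \<sigma>'. exec W c \<sigma> t \<sigma>' \<and> real t \<le> k \<and> Q \<sigma>')"

definition hoare :: "nat \<Rightarrow> (store \<Rightarrow> bool) \<Rightarrow> com \<Rightarrow> real \<Rightarrow> (store \<Rightarrow> bool) \<Rightarrow> bool" where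
  "hoare W P c k Q \<longleftrightarrow> (\<forall>\<sigma>. P \<sigma> \<longrightarrow> terminates_within W c k Q \<sigma>)"

lemma wp_atomic [simp]:
  "wp W Skip Q t \<sigma> \<longleftrightarrow> Q (Suc t) \<sigma>"
  "wp W (Const x k) Q t \<sigma> \<longleftrightarrow> k \<le> W \<and> Q (Suc t) (\<sigma>\<lparr>reg := (reg \<sigma>)(x := k)\<rparr>)"
  "wp W (Bin x f y z) Q t \<sigma> \<longleftrightarrow> binop_val f (reg \<sigma> y) (reg \<sigma> z) \<le> W \<and>
     Q (Suc t) (\<sigma>\<lparr>reg := (reg \<sigma>)(x := binop_val f (reg \<sigma> y) (reg \<sigma> z))\<rparr>)"
  "wp W (Load x a i) Q t \<sigma> \<longleftrightarrow> Q (Suc t) (\<sigma>\<lparr>reg := (reg \<sigma>)(x := arr \<sigma> a (reg \<sigma> i))\<rparr>)"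
  "wp W (Store a i x) Q t \<sigma> \<longleftrightarrow>
     Q (Suc t) (\<sigma>\<lparr>arr := (arr \<sigma>)(a := (arr \<sigma> a)(reg \<sigma> i := reg \<sigma> x))\<rparr>)"
  by (auto simp: wp_def exec_simps)

lemma wp_Seq [simp]: "wp W (c ;; d) Q = wp W c (wp W d Q)"
  by (intro ext) (auto simp: wp_def exec_simps add.assoc; metis)

lemma wp_If [simp]:
  "wp W (If x c d) Q t \<sigma> \<longleftrightarrow>
     (if reg \<sigma> x \<noteq> 0 then wp W c Q (Suc t) \<sigma> else wp W d Q (Suc t) \<sigma>)"
  by (auto simp: wp_def exec_simps; metis add_Suc_right)

lemma terminates_within_iff_wp:
  "terminates_within W c k Q \<sigma> \<longleftrightarrow> wp W c (\<lambda>t \<sigma>'. real t \<le> k \<and> Q \<sigma>') 0 \<sigma>"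
  by (simp add: terminates_within_def wp_def)

lemma hoare_wpI:
  assumes "\<And>\<sigma>. P \<sigma> \<Longrightarrow> wp W c (\<lambda>t \<sigma>'. real t \<le> k \<and> Q \<sigma>') 0 \<sigma>"
  shows "hoare W P c k Q"
  using assms by (simp add: hoare_def terminates_within_iff_wp)

lemma hoare_terminates_within: "hoare W (terminates_within W c k Q) c k Q"
  by (simp add: hoare_def)

lemma terminates_within_mono:
  assumes "terminates_within W c k Q \<sigma>" "k \<le> k'" "\<And>\<sigma>. Q \<sigma> \<Longrightarrow> Q' \<sigma>"
  shows "terminates_within W c k' Q' \<sigma>"
  using assms unfolding terminates_within_def by fastforce

lemma hoare_conseq:
  assumes "hoare W P c k Q" "\<And>\<sigma>. P' \<sigma> \<Longrightarrow> P \<sigma>" "k \<le> k'" "\<And>\<sigma>. Q \<sigma> \<Longrightarrow> Q' \<sigma>"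
  shows "hoare W P' c k' Q'"
  using assms terminates_within_mono unfolding hoare_def by blast

lemma hoare_Seq:
  assumes "hoare W P c k Q" "hoare W Q d l R"
  shows "hoare W P (c ;; d) (k + l) R"
proof -
  have "terminates_within W (c ;; d) (k + l) R \<sigma>" if pre: "P \<sigma>" for \<sigma>
  proof -
    obtain t \<sigma>' where first: "exec W c \<sigma> t \<sigma>'" "real t \<le> k" "Q \<sigma>'"
      using assms(1) pre unfolding hoare_def terminates_within_def by blast
    obtain t' \<sigma>'' where second: "exec W d \<sigma>' t' \<sigma>''" "real t' \<le> l" "R \<sigma>''"
      using assms(2) first(3) unfolding hoare_def terminates_within_def by blast
    from exec.Seq[OF first(1) second(1)] first(2) second(2,3) show ?thesis
      unfolding terminates_within_def by (intro exI[of _ "t + t'"] exI[of _ \<sigma>'']) simp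
  qed
  then show ?thesis by (simp add: hoare_def)
qed

lemma hoare_Seq_assoc: "hoare W P ((c ;; d) ;; e) k Q \<longleftrightarrow> hoare W P (c ;; d ;; e) k Q"
  by (simp add: hoare_def terminates_within_iff_wp)

lemma hoare_If:
  assumes "hoare W (\<lambda>\<sigma>. P \<sigma> \<and> reg \<sigma> x \<noteq> 0) c k Q" "hoare W (\<lambda>\<sigma>. P \<sigma> \<and> reg \<sigma> x = 0) d k Q"
  shows "hoare W P (If x c d) (k + 1) Q"
proof -
  have "terminates_within W (If x c d) (k + 1) Q \<sigma>" if pre: "P \<sigma>" for \<sigma>
  proof (cases "reg \<sigma> x = 0")
    case True
    obtain t \<sigma>' where "exec W d \<sigma> t \<sigma>'" "real t \<le> k" "Q \<sigma>'"
      using assms(2) pre True unfolding hoare_def terminates_within_def by blast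
    then show ?thesis
      using exec.IfFalse[OF True] unfolding terminates_within_def by fastforce
  next
    case False
    obtain t \<sigma>' where "exec W c \<sigma> t \<sigma>'" "real t \<le> k" "Q \<sigma>'"
      using assms(1) pre False unfolding hoare_def terminates_within_def by blast
    then show ?thesis
      using exec.IfTrue[OF False] unfolding terminates_within_def by fastforce
  qed
  then show ?thesis by (simp add: hoare_def)
qed

lemma hoare_While_count:
  assumes body: "\<And>i. i < m \<Longrightarrow> hoare W (J i) c k (J (Suc i))"
    and guard: "\<And>i \<sigma>. i \<le> m \<Longrightarrow> J i \<sigma> \<Longrightarrow> reg \<sigma> x \<noteq> 0 \<longleftrightarrow> i < m"
  shows "hoare W (J 0) (While x c) (real m * (k + 1) + 1) (J m)"
proof -
  have "hoare W (J i) (While x c) (real (m - i) * (k + 1) + 1) (J m)" if "i \<le> m" for i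
    using that
  proof (induction rule: inc_induct)
    case base
    have "terminates_within W (While x c) 1 (J m) \<sigma>" if "J m \<sigma>" for \<sigma>
      using guard[OF order.refl that] exec.WhileFalse[of \<sigma> x W c] that
      by (force simp: terminates_within_def)
    then show ?case by (simp add: hoare_def)
  next
    case (step i)
    have "terminates_within W (While x c) (real (m - i) * (k + 1) + 1) (J m) \<sigma>"
      if inv: "J i \<sigma>" for \<sigma>
    proof -
      obtain t \<sigma>' where iteration: "exec W c \<sigma> t \<sigma>'" "real t \<le> k" "J (Suc i) \<sigma>'"
        using body[OF step.hyps(2)] inv unfolding hoare_def terminates_within_def by blast
      obtain t' \<sigma>'' where loop: "exec W (While x c) \<sigma>' t' \<sigma>''"
        "real t' \<le> real (m - Suc i) * (k + 1) + 1" "J m \<sigma>''"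
        using step.IH iteration(3) unfolding hoare_def terminates_within_def by blast
      have "exec W (While x c) \<sigma> (1 + t + t') \<sigma>''"
        using guard[of i \<sigma>] step.hyps inv by (intro exec.WhileTrue[OF _ iteration(1) loop(1)]) auto
      moreover have "real (1 + t + t') \<le> real (m - i) * (k + 1) + 1"
        using iteration(2) loop(2) step.hyps(2) by (simp add: Suc_diff_Suc[symmetric] algebra_simps)
      ultimately show ?thesis using loop(3) unfolding terminates_within_def by blast
    qed
    then show ?case by (simp add: hoare_def)
  qed
  from this[of 0] show ?thesis by simp
qed

definition for_loop :: "name \<Rightarrow> com \<Rightarrow> com" where
  "for_loop b c = Const ''x'' 0 ;; Bin ''go'' Less ''x'' b ;;
     While ''go'' (c ;; Bin ''x'' Add ''x'' ''1'' ;; Bin ''go'' Less ''x'' b)"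

lemma hoare_for_loop:
  assumes body: "\<And>i. i < m \<Longrightarrow>
      hoare W (\<lambda>\<sigma>. J i \<sigma> \<and> reg \<sigma> ''x'' = i) c k (\<lambda>\<sigma>. J (Suc i) \<sigma> \<and> reg \<sigma> ''x'' = i)"
    and regs: "\<And>i \<sigma>. J i \<sigma> \<Longrightarrow> reg \<sigma> b = m \<and> reg \<sigma> ''1'' = 1"
    and counter: "\<And>i \<sigma> y z. J i \<sigma> \<Longrightarrow> J i (\<sigma>\<lparr>reg := (reg \<sigma>)(''x'' := y, ''go'' := z)\<rparr>)"
    and bound_name: "b \<noteq> ''x''" "b \<noteq> ''go''" and word_size: "m \<le> W" "1 \<le> W"
  shows "hoare W (J 0) (for_loop b c) (real m * (k + 3) + 3) (J m)"
proof -
  define J' where "J' i \<sigma> \<longleftrightarrow> J i \<sigma> \<and> reg \<sigma> ''x'' = i \<and> reg \<sigma> ''go'' = of_bool (i < m)" for i \<sigma>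
  have "hoare W (J' i) (c ;; Bin ''x'' Add ''x'' ''1'' ;; Bin ''go'' Less ''x'' b) (k + 2)
      (J' (Suc i))" if i: "i < m" for i
  proof (rule hoare_Seq)
    show "hoare W (J' i) c k (\<lambda>\<sigma>. J (Suc i) \<sigma> \<and> reg \<sigma> ''x'' = i)"
      by (rule hoare_conseq[OF body[OF i]]) (auto simp: J'_def)
    show "hoare W (\<lambda>\<sigma>. J (Suc i) \<sigma> \<and> reg \<sigma> ''x'' = i)
        (Bin ''x'' Add ''x'' ''1'' ;; Bin ''go'' Less ''x'' b) 2 (J' (Suc i))"
      by (rule hoare_wpI) (use regs counter bound_name word_size i in \<open>auto simp: J'_def\<close>)
  qed
  then have loop: "hoare W (J' 0)
      (While ''go'' (c ;; Bin ''x'' Add ''x'' ''1'' ;; Bin ''go'' Less ''x'' b))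
      (real m * (k + 2 + 1) + 1) (J' m)"
    by (rule hoare_While_count) (auto simp: J'_def)
  have "hoare W (J 0) (Const ''x'' 0 ;; Bin ''go'' Less ''x'' b) 2 (J' 0)"
    by (rule hoare_wpI) (use regs counter bound_name word_size in \<open>auto simp: J'_def\<close>)
  from hoare_Seq[OF this loop]
  have "hoare W (J 0) (for_loop b c) (2 + (real m * (k + 2 + 1) + 1)) (J' m)"
    unfolding for_loop_def hoare_Seq_assoc .
  then show ?thesis
    by (rule hoare_conseq) (auto simp: J'_def algebra_simps)
qed

lemma hoare_rename:
  assumes "hoare W P c k Q" "inj f" "W \<le> W'" and "\<And>\<tau> \<sigma>. R \<tau> \<Longrightarrow> R (embed_store f \<tau> \<sigma>)"
  shows "hoare W' (\<lambda>\<tau>. P (restrict_store f \<tau>) \<and> R \<tau>) (rename f c) k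
    (\<lambda>\<tau>. Q (restrict_store f \<tau>) \<and> R \<tau>)"
proof -
  have "terminates_within W' (rename f c) k (\<lambda>\<tau>. Q (restrict_store f \<tau>) \<and> R \<tau>) \<tau>"
    if "P (restrict_store f \<tau>)" "R \<tau>" for \<tau>
  proof -
    obtain t \<sigma>' where original: "exec W c (restrict_store f \<tau>) t \<sigma>'" "real t \<le> k" "Q \<sigma>'"
      using assms(1) \<open>P _\<close> by (auto simp: hoare_def terminates_within_def)
    have "exec W' (rename f c) \<tau> t (embed_store f \<tau> \<sigma>')"
      using exec_rename[OF original(1) assms(2,3), of \<tau>] assms(2)
      by (simp add: embed_restrict_store)
    with original(2,3) assms(2,4) \<open>R \<tau>\<close> show ?thesis
      unfolding terminates_within_def by (intro exI[of _ t] exI) (auto simp: restrict_embed_store)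
  qed
  then show ?thesis by (simp add: hoare_def)
qed

subsection \<open>The simulated dynamic algorithm\<close>

primrec serves ::
  "dyn_alg \<Rightarrow> nat \<Rightarrow> real \<Rightarrow> real \<Rightarrow> request list \<Rightarrow> nat list \<Rightarrow> store \<Rightarrow> bool" where
  "serves A W U Q [] as \<sigma> \<longleftrightarrow> as = []"
| "serves A W U Q (r # \<rho>) as \<sigma> \<longleftrightarrow>
     (case r of
        Update u v \<Rightarrow>
          terminates_within W (dyn_update A) U (serves A W U Q \<rho> as) (update_input u v \<sigma>)
      | Query \<Rightarrow>
          terminates_within W (dyn_query A) Q
            (\<lambda>\<sigma>'. \<exists>as'. as = reg \<sigma>' ''answer'' # as' \<and> serves A W U Q \<rho> as' \<sigma>') \<sigma>)"

lemma dyn_serve_imp_serves: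
  assumes "dyn_serve A W \<sigma> \<rho> ts as"
    and "\<forall>i<length \<rho>. real (ts ! i) \<le> request_time U Q (\<rho> ! i)"
  shows "serves A W U Q \<rho> as \<sigma>"
  using assms
proof induction
  case (Update u v \<sigma> t \<sigma>' \<rho> ts as)
  then have "real t \<le> U" "serves A W U Q \<rho> as \<sigma>'"
    by (auto simp: All_less_Suc2 request_time_def)
  with Update.hyps(1) show ?case by (auto simp: terminates_within_def)
next
  case (Query \<sigma> t \<sigma>' \<rho> ts as)
  then have "real t \<le> Q" "serves A W U Q \<rho> as \<sigma>'"
    by (auto simp: All_less_Suc2 request_time_def)
  with Query.hyps(1) show ?case by (auto simp: terminates_within_def)
qed simp

lemma dyn_serve_length: "dyn_serve A W \<sigma> \<rho> ts as \<Longrightarrow> length ts = length \<rho>"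
  by (induction rule: dyn_serve.induct) auto

text \<open>No name of the OuMv interface or introduced by the reduction starts with the letter z.\<close>

definition tag :: "name \<Rightarrow> name" where
  "tag x = CHR ''z'' # x"

lemma inj_tag: "inj tag"
  by (simp add: inj_def tag_def)

lemma tag_eq [simp]:
  "tag x = tag y \<longleftrightarrow> x = y" "tag x = c # cs \<longleftrightarrow> c = CHR ''z'' \<and> x = cs"
  "c # cs = tag x \<longleftrightarrow> c = CHR ''z'' \<and> x = cs"
  by (auto simp: tag_def)

abbreviation hidden :: "store \<Rightarrow> store" where
  "hidden \<equiv> restrict_store tag"

lemma comp_tag_upd [simp]:
  "g(tag x := v) \<circ> tag = (g \<circ> tag)(x := v)"
  "c \<noteq> CHR ''z'' \<Longrightarrow> g(c # cs := v) \<circ> tag = g \<circ> tag"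
  by (auto simp: fun_eq_iff)

lemma embed_store_tag [simp]:
  assumes "c \<noteq> CHR ''z''"
  shows "reg (embed_store tag \<tau> \<sigma>) (c # cs) = reg \<tau> (c # cs)"
    "arr (embed_store tag \<tau> \<sigma>) (c # cs) = arr \<tau> (c # cs)"
  using assms by (auto simp: embed_store_def)

subsection \<open>Delayed predictions\<close>

lemma close_to_id_iff:
  "close_to_id d T \<pi> \<longleftrightarrow> \<pi> permutes {..<T} \<and> (\<forall>t<T. \<bar>int (\<pi> t) - int t\<bar> \<le> int d)"
proof (cases "\<pi> permutes {..<T}")
  case True
  have "(\<forall>t<T. \<bar>int (inv \<pi> t) - int t\<bar> \<le> int d) \<longleftrightarrow> (\<forall>t\<in>\<pi> ` {..<T}. \<bar>int (inv \<pi> t) - int t\<bar> \<le> int d)"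
    using permutes_image[OF True] by auto
  then show ?thesis
    using True
    by (simp add: close_to_id_def permutes_inverses abs_minus_commute Ball_def[of "{..<T}"])
qed (simp add: close_to_id_def)

lemma close_to_id_append:
  assumes "close_to_id d (length xs) p" "close_to_id d (length ys) q"
  shows "\<exists>\<pi>. close_to_id d (length (xs @ ys)) \<pi> \<and>
    permute_list \<pi> (xs @ ys) = permute_list p xs @ permute_list q ys"
proof -
  define a b where "a = length xs" and "b = length ys"
  define \<pi> where "\<pi> t = (if t < a then p t else if t < a + b then a + q (t - a) else t)" for t
  have p_close: "p permutes {..<a}" "\<And>t. t < a \<Longrightarrow> \<bar>int (p t) - int t\<bar> \<le> int d"
    and q_close: "q permutes {..<b}" "\<And>t. t < b \<Longrightarrow> \<bar>int (q t) - int t\<bar> \<le> int d"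
    using assms by (auto simp: close_to_id_iff a_def b_def)
  have p_less: "p t < a \<longleftrightarrow> t < a" and q_less: "q t < b \<longleftrightarrow> t < b" for t
    using permutes_in_image[OF p_close(1), of t] permutes_in_image[OF q_close(1), of t] by simp_all
  have "\<pi> permutes {..<a + b}"
  proof (rule bij_imp_permutes)
    have "inj_on \<pi> {..<a + b}"
    proof (rule inj_onI)
      fix s t assume range: "s \<in> {..<a + b}" "t \<in> {..<a + b}" and eq: "\<pi> s = \<pi> t"
      then have "s < a \<longleftrightarrow> t < a"
        using p_less[of s] p_less[of t] by (auto simp: \<pi>_def split: if_splits)
      with range eq have "p s = p t \<or> s \<ge> a \<and> t \<ge> a \<and> q (s - a) = q (t - a)"
        by (cases "s < a") (simp_all add: \<pi>_def)
      then show "s = t"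
        using injD[OF permutes_inj[OF p_close(1)], of s t]
          injD[OF permutes_inj[OF q_close(1)], of "s - a" "t - a"]
        by linarith
    qed
    moreover have "\<pi> t < a + b" if "t < a + b" for t
      using p_less[of t] q_less[of "t - a"] that by (auto simp: \<pi>_def)
    ultimately show "bij_betw \<pi> {..<a + b} {..<a + b}"
      by (intro bij_betw_imageI endo_inj_surj) auto
  qed (simp add: \<pi>_def)
  moreover have "\<bar>int (\<pi> t) - int t\<bar> \<le> int d" if "t < a + b" for t
    using p_close(2)[of t] q_close(2)[of "t - a"] that
    by (auto simp: \<pi>_def less_diff_conv2 algebra_simps)
  moreover have "permute_list \<pi> (xs @ ys) = permute_list p xs @ permute_list q ys"
    using p_less q_less
    by (intro nth_equalityI)
      (simp_all add: permute_list_def nth_append \<pi>_def a_def b_def less_diff_conv2)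
  ultimately show ?thesis by (auto simp: close_to_id_iff a_def b_def)
qed

lemma delayed_for_append:
  assumes "delayed_for d xs' {xs}" "delayed_for d ys' {ys}"
  shows "delayed_for d (xs' @ ys') {xs @ ys}"
proof -
  obtain p q where "close_to_id d (length xs) p" "permute_list p xs = xs'"
    "close_to_id d (length ys) q" "permute_list q ys = ys'"
    using assms by (auto simp: delayed_for_def)
  then show ?thesis using close_to_id_append[of d xs p ys q] by (auto simp: delayed_for_def)
qed

lemma delayed_for_refl: "delayed_for d xs {xs}"
  by (auto intro!: exI[of _ id] simp: delayed_for_def close_to_id_iff permutes_id permute_list_id)

lemma delayed_for_concat:
  assumes "list_all2 (\<lambda>xs' xs. delayed_for d xs' {xs}) xss' xss"
  shows "delayed_for d (concat xss') {concat xss}"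
  using assms by induction (auto intro: delayed_for_append delayed_for_refl)

lemma delayed_for_mset_eq:
  assumes "mset xs' = mset xs" "length xs \<le> d + 1"
  shows "delayed_for d xs' {xs}"
proof -
  obtain p where perm: "p permutes {..<length xs}" "permute_list p xs = xs'"
    using mset_eq_permutation[OF assms(1)] by auto
  have "\<bar>int (p t) - int t\<bar> \<le> int d" if "t < length xs" for t
    using permutes_in_image[OF perm(1), of t] that assms(2) by auto
  then show ?thesis using perm by (auto simp: delayed_for_def close_to_id_iff)
qed

subsection \<open>Edge flips and triangles\<close>

definition updates :: "(nat \<times> nat) list \<Rightarrow> request list" where
  "updates es = map (\<lambda>(x, y). Update x y) es"

definition edges :: "(nat \<times> nat) list \<Rightarrow> graph" where
  "edges es = (\<lambda>(x, y). {x, y}) ` set es"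

definition flips :: "(nat \<times> nat) list \<Rightarrow> graph \<Rightarrow> graph" where
  "flips es = fold (\<lambda>(x, y). flip_edge {x, y}) es"

lemma correct_answers_updates:
  "correct_answers n s G (updates es @ \<rho>) = correct_answers n s (flips es G) \<rho>"
  by (induction es arbitrary: G) (auto simp: flips_def updates_def)

lemma flips_distinct:
  assumes "distinct es" "\<And>x y. (x, y) \<in> set es \<Longrightarrow> x < y"
  shows "flips es G = sym_diff G (edges es)"
  using assms
proof (induction es arbitrary: G)
  case (Cons e es)
  obtain x y where e_eq: "e = (x, y)" by (cases e)
  have "{x, y} \<notin> edges es"
  proof
    assume "{x, y} \<in> edges es"
    then obtain x' y' where "(x', y') \<in> set es" "{x, y} = {x', y'}" by (auto simp: edges_def)
    moreover from this Cons.prems(2) have "x' < y'" "x < y" by (auto simp: e_eq)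
    ultimately show False using Cons.prems(1) by (auto simp: e_eq doubleton_eq_iff)
  qed
  moreover have "flips (e # es) G = sym_diff (flip_edge {x, y} G) (edges es)"
    using Cons by (simp add: flips_def e_eq)
  moreover have "edges (e # es) = insert {x, y} (edges es)"
    by (simp add: edges_def e_eq)
  ultimately show ?case by (auto simp: flip_edge_def)
qed (simp add: flips_def edges_def)

lemma card_triangles_at_pos_iff:
  assumes "s < n"
  shows "card (triangles_at n s G) > 0 \<longleftrightarrow>
    (\<exists>x<n. \<exists>y<n. x \<noteq> s \<and> y \<noteq> s \<and> x \<noteq> y \<and> {x, y} \<in> G \<and> {x, s} \<in> G \<and> {y, s} \<in> G)"
    (is "_ \<longleftrightarrow> ?triangle")
proof -
  have "finite (triangles_at n s G)"
    by (rule finite_subset[of _ "Pow {..<n}"]) (auto simp: triangles_at_def)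
  then have "card (triangles_at n s G) > 0 \<longleftrightarrow> triangles_at n s G \<noteq> {}"
    by (simp add: card_gt_0_iff)
  also have "\<dots> \<longleftrightarrow> ?triangle"
  proof
    assume "triangles_at n s G \<noteq> {}"
    then obtain S where triangle: "S \<subseteq> {..<n}" "card S = 3" "s \<in> S"
      "\<And>x y. x \<in> S \<Longrightarrow> y \<in> S \<Longrightarrow> x \<noteq> y \<Longrightarrow> {x, y} \<in> G"
      unfolding triangles_at_def by blast
    have "card (S - {s}) = 2" using triangle(2,3) by simp
    then obtain x y where "S - {s} = {x, y}" "x \<noteq> y" by (auto simp: card_2_iff)
    then have "x \<in> S" "y \<in> S" "x \<noteq> s" "y \<noteq> s" by auto
    with triangle \<open>x \<noteq> y\<close> show ?triangle by blast
  next
    assume ?triangle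
    then obtain x y where "x < n" "y < n" "x \<noteq> s" "y \<noteq> s" "x \<noteq> y"
      "{x, y} \<in> G" "{x, s} \<in> G" "{y, s} \<in> G" by blast
    with assms have "{x, y, s} \<in> triangles_at n s G"
      by (auto simp: triangles_at_def insert_commute)
    then show "triangles_at n s G \<noteq> {}" by blast
  qed
  finally show ?thesis .
qed

subsection \<open>Encoding of vectors and matrices\<close>

definition joint_vector :: "nat \<Rightarrow> bool_vec \<Rightarrow> bool_vec \<Rightarrow> bool_vec" where
  "joint_vector n u v x = (if x < n then u x else v (x - n))"

definition spokes :: "nat \<Rightarrow> bool_vec \<Rightarrow> (nat \<times> nat) list" where
  "spokes n P = map (\<lambda>x. (x, 3 * n)) (filter P [0..<2 * n])"

definition matrix_edges :: "nat \<Rightarrow> bool_mat \<Rightarrow> (nat \<times> nat) list" where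
  "matrix_edges n M =
    map (\<lambda>(i, j). (i, if M i j then n + j else 2 * n + j)) (List.product [0..<n] [0..<n])"

lemma set_spokes: "set (spokes n P) = {(x, 3 * n) | x. x < 2 * n \<and> P x}"
  by (auto simp: spokes_def)

lemma spoke_in_edges_iff: "{x, 3 * n} \<in> edges (spokes n P) \<longleftrightarrow> x < 2 * n \<and> P x"
  by (auto simp: edges_def set_spokes doubleton_eq_iff)

lemma flips_spokes: "flips (spokes n P) G = sym_diff G (edges (spokes n P))"
  by (rule flips_distinct) (auto simp: set_spokes, auto simp: spokes_def distinct_map inj_on_def)

lemma length_matrix_edges: "length (matrix_edges n M) = n * n"
  by (simp add: matrix_edges_def)

lemma set_matrix_edges:
  "set (matrix_edges n M) =
    (\<lambda>(i, j). (i, if M i j then n + j else 2 * n + j)) ` ({..<n} \<times> {..<n})"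
  by (simp add: matrix_edges_def lessThan_atLeast0)

lemma flips_matrix_edges: "flips (matrix_edges n M) {} = edges (matrix_edges n M)"
proof -
  have "inj_on (\<lambda>(i, j). (i, if M i j then n + j else 2 * n + j)) ({..<n} \<times> {..<n})"
    by (auto simp: inj_on_def split: if_splits)
  then have "distinct (matrix_edges n M)"
    by (simp add: matrix_edges_def distinct_map distinct_product lessThan_atLeast0)
  moreover have "x < y" if "(x, y) \<in> set (matrix_edges n M)" for x y
    using that by (auto simp: set_matrix_edges split: if_splits)
  ultimately show ?thesis by (simp add: flips_distinct)
qed

lemma joint_vector_covers_matrix_edge_iff_uMv:
  "(\<exists>x<2 * n. \<exists>y<2 * n. x \<noteq> y \<and> {x, y} \<in> edges (matrix_edges n M) \<and>
     joint_vector n u v x \<and> joint_vector n u v y) \<longleftrightarrow> uMv n M u v" (is "?covered \<longleftrightarrow> _")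
proof
  assume ?covered
  then obtain x y where covered: "x < 2 * n" "y < 2 * n" "joint_vector n u v x" "joint_vector n u v y"
    "{x, y} \<in> edges (matrix_edges n M)" by blast
  then obtain i j where entry: "i < n" "j < n" "{x, y} = {i, if M i j then n + j else 2 * n + j}"
    by (auto simp: edges_def set_matrix_edges)
  define y' where "y' = (if M i j then n + j else 2 * n + j)"
  have "joint_vector n u v i" "y' < 2 * n" "joint_vector n u v y'"
    using covered(1-4) entry(3) by (auto simp: y'_def[symmetric] doubleton_eq_iff)
  with entry(1,2) have "u i \<and> M i j \<and> v j"
    by (cases "M i j") (simp_all add: y'_def joint_vector_def)
  with entry(1,2) show "uMv n M u v" by (auto simp: uMv_def)
next
  assume "uMv n M u v"
  then obtain i j where entry: "i < n" "j < n" "u i" "M i j" "v j" by (auto simp: uMv_def)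
  then have "(i, n + j) \<in> set (matrix_edges n M)"
    by (auto simp: set_matrix_edges intro!: image_eqI[of _ _ "(i, j)"])
  then have "{i, n + j} \<in> edges (matrix_edges n M)" by (force simp: edges_def)
  with entry show ?covered
    by (intro exI[of _ i] conjI exI[of _ "n + j"]) (auto simp: joint_vector_def)
qed

lemma triangle_iff_uMv:
  "card (triangles_at (3 * n + 1) (3 * n)
      (flips (spokes n (joint_vector n u v)) (edges (matrix_edges n M)))) > 0 \<longleftrightarrow> uMv n M u v"
    (is "card (triangles_at _ _ ?G) > 0 \<longleftrightarrow> _")
proof -
  have "{x, 3 * n} \<notin> edges (matrix_edges n M)" for x
    by (auto simp: edges_def set_matrix_edges doubleton_eq_iff split: if_splits)
  then have spoke: "{x, 3 * n} \<in> ?G \<longleftrightarrow> x < 2 * n \<and> joint_vector n u v x" for x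
    by (simp add: flips_spokes spoke_in_edges_iff)
  have matrix: "{x, y} \<in> ?G \<longleftrightarrow> {x, y} \<in> edges (matrix_edges n M)"
    if "x \<noteq> 3 * n" "y \<noteq> 3 * n" for x y
  proof -
    have "{x, y} \<notin> edges (spokes n (joint_vector n u v))"
      using that by (auto simp: edges_def set_spokes doubleton_eq_iff)
    then show ?thesis by (simp add: flips_spokes)
  qed
  have not_source: "x < 3 * n + 1 \<and> x \<noteq> 3 * n" if "x < 2 * n" for x
    using that by simp
  show ?thesis
    unfolding joint_vector_covers_matrix_edge_iff_uMv[symmetric]
      card_triangles_at_pos_iff[OF less_add_one] spoke
    using matrix not_source by blast
qed

subsection \<open>Requests and predictions of the reduction\<close>

definition round_requests :: "nat \<Rightarrow> bool_vec \<Rightarrow> bool_vec \<Rightarrow> request list" where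
  "round_requests n u v =
    updates (spokes n (joint_vector n u v)) @ Query #
    updates (spokes n (\<lambda>x. \<not> joint_vector n u v x)) @ updates (spokes n (\<lambda>_. True))"

definition predicted_round :: "nat \<Rightarrow> request list" where
  "predicted_round n = updates (spokes n (\<lambda>_. True)) @ Query # updates (spokes n (\<lambda>_. True))"

abbreviation online_requests :: "nat \<Rightarrow> (bool_vec \<times> bool_vec) list \<Rightarrow> request list" where
  "online_requests n uvs \<equiv> concat (map (\<lambda>(u, v). round_requests n u v) uvs)"

definition requests :: "nat \<Rightarrow> bool_mat \<Rightarrow> (bool_vec \<times> bool_vec) list \<Rightarrow> request list" where
  "requests n M uvs = updates (matrix_edges n M) @ online_requests n uvs"

definition prediction :: "nat \<Rightarrow> bool_mat \<Rightarrow> request list" where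
  "prediction n M = updates (matrix_edges n M) @ concat (replicate n (predicted_round n))"

lemma mset_predicted_round: "mset (predicted_round n) = mset (round_requests n u v)"
proof -
  have "mset (updates (spokes n P)) + mset (updates (spokes n (\<lambda>x. \<not> P x))) =
      mset (updates (spokes n (\<lambda>_. True)))" for P
    unfolding updates_def spokes_def map_map mset_map mset_filter image_mset_union[symmetric]
      multiset_partition[symmetric] by simp
  from this[of "joint_vector n u v", symmetric] show ?thesis
    by (simp add: predicted_round_def round_requests_def)
qed

lemma length_predicted_round: "length (predicted_round n) = 4 * n + 1"
  by (simp add: predicted_round_def updates_def spokes_def)

definition prediction_length :: "nat \<Rightarrow> nat" where
  "prediction_length n = n * n + n * (4 * n + 1)"

lemma length_prediction: "length (prediction n M) = prediction_length n"
  by (simp add: prediction_length_def prediction_def updates_def length_matrix_edges length_concat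
      sum_list_replicate length_predicted_round)

lemma valid_prediction:
  assumes "r \<in> set (prediction n M)"
  shows "valid_request (3 * n + 1) r"
  using assms
  by (cases "n = 0") (auto simp: prediction_def predicted_round_def updates_def set_spokes
      set_matrix_edges valid_request_def matrix_edges_def)

lemma prediction_delayed_for_requests:
  assumes "length uvs = n" "4 * n \<le> d"
  shows "delayed_for d (prediction n M) {requests n M uvs}"
proof -
  have "length (round_requests n u v) = 4 * n + 1" for u v
    using mset_predicted_round[of n u v] by (metis length_predicted_round size_mset)
  then have "delayed_for d (predicted_round n) {round_requests n u v}" for u v
    using assms(2) by (intro delayed_for_mset_eq mset_predicted_round) simp
  then have "list_all2 (\<lambda>xs' xs. delayed_for d xs' {xs}) (replicate n (predicted_round n))
      (map (\<lambda>(u, v). round_requests n u v) uvs)"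
    using assms by (auto simp: list_all2_conv_all_nth split: prod.split)
  then show ?thesis
    unfolding prediction_def requests_def
    by (intro delayed_for_append delayed_for_refl delayed_for_concat)
qed

lemma flips_round:
  "flips (spokes n (\<lambda>_. True)) (flips (spokes n (\<lambda>x. \<not> P x)) (flips (spokes n P) G)) = G"
proof -
  have "edges (spokes n (\<lambda>_. True)) = edges (spokes n P) \<union> edges (spokes n (\<lambda>x. \<not> P x))"
    by (auto simp: edges_def set_spokes)
  moreover have "edges (spokes n P) \<inter> edges (spokes n (\<lambda>x. \<not> P x)) = {}"
    by (auto simp: edges_def set_spokes doubleton_eq_iff)
  ultimately show ?thesis unfolding flips_spokes by blast
qed

lemma correct_answers_requests:
  "map (\<lambda>a. of_bool (0 < a)) (correct_answers (3 * n + 1) (3 * n) {} (requests n M uvs)) =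
   map (\<lambda>(u, v). of_bool (uMv n M u v)) uvs"
proof -
  have "map (\<lambda>a. of_bool (0 < a)) (correct_answers (3 * n + 1) (3 * n) (edges (matrix_edges n M))
      (online_requests n uvs)) = map (\<lambda>(u, v). of_bool (uMv n M u v)) uvs"
    by (induction uvs)
      (auto simp: round_requests_def correct_answers_updates flips_round
        triangle_iff_uMv[symmetric])
  then show ?thesis by (simp add: requests_def correct_answers_updates flips_matrix_edges)
qed

lemma nth_concat_replicate:
  "i < m * length xs \<Longrightarrow> concat (replicate m xs) ! i = xs ! (i mod length xs)"
proof (induction m arbitrary: i)
  case (Suc m)
  then show ?case by (cases "i < length xs") (auto simp: nth_append le_mod_geq)
qed simp

lemma nth_predicted_round:
  assumes "j < 4 * n + 1"
  shows "predicted_round n ! j =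
    (let x = j mod (2 * n + 1) in if x < 2 * n then Update x (3 * n) else Query)"
proof -
  consider "j < 2 * n" | "j = 2 * n" | "2 * n < j" by linarith
  then show ?thesis
  proof cases
    case 3
    then have less: "j - (2 * n + 1) < 2 * n" using assms by linarith
    with 3 have "j mod (2 * n + 1) = j - (2 * n + 1)" by (subst le_mod_geq) auto
    with less 3 assms show ?thesis
      by (simp add: Let_def predicted_round_def updates_def spokes_def nth_append nth_Cons')
  qed (simp_all add: predicted_round_def updates_def spokes_def nth_append)
qed

lemma nth_prediction:
  assumes "i < prediction_length n"
  shows "prediction n M ! i =
    (if i < n * n then case matrix_edges n M ! i of (x, y) \<Rightarrow> Update x y
     else let x = (i - n * n) mod (4 * n + 1) mod (2 * n + 1) in
       if x < 2 * n then Update x (3 * n) else Query)"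
proof (cases "i < n * n")
  case True
  then show ?thesis
    by (simp add: prediction_def nth_append updates_def length_matrix_edges split: prod.split)
next
  case False
  then have "prediction n M ! i = concat (replicate n (predicted_round n)) ! (i - n * n)"
    by (simp add: prediction_def nth_append updates_def length_matrix_edges)
  also have "\<dots> = predicted_round n ! ((i - n * n) mod (4 * n + 1))"
    using nth_concat_replicate[of "i - n * n" n "predicted_round n"] assms False
    by (simp add: prediction_length_def length_predicted_round)
  also have "\<dots> = (let x = (i - n * n) mod (4 * n + 1) mod (2 * n + 1) in
      if x < 2 * n then Update x (3 * n) else Query)"
    by (rule nth_predicted_round) simp
  finally show ?thesis using False by simp
qed

lemma div_mod_less_square: "i < n * n \<Longrightarrow> i div n < n \<and> i mod n < (n :: nat)"
  by (auto simp: less_mult_imp_div_less intro!: mod_less_divisor gr0I)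

lemma nth_matrix_edges:
  assumes "i < n * n"
  shows "matrix_edges n M ! i =
    (i div n, if M (i div n) (i mod n) then n + i mod n else 2 * n + i mod n)"
  using assms div_mod_less_square[OF assms] by (simp add: matrix_edges_def product_nth)

subsection \<open>The reduction\<close>

text \<open>The register \<open>''0''\<close> is never assigned and keeps its initial value \<open>0\<close>.\<close>

definition call_update :: "dyn_alg \<Rightarrow> name \<Rightarrow> name \<Rightarrow> com" where
  "call_update A y z =
     Bin (tag ''u'') Add y ''0'' ;; Bin (tag ''v'') Add z ''0'' ;; rename tag (dyn_update A)"

definition flip_spokes :: "dyn_alg \<Rightarrow> com \<Rightarrow> com" where
  "flip_spokes A g = for_loop ''2n'' (g ;; If ''c'' (call_update A ''x'' ''3n'') Skip)"

definition read_joint_vector :: com where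
  "read_joint_vector = Bin ''c'' Less ''x'' ''n'' ;;
     If ''c'' (Load ''c'' ''u'' ''x'') (Bin ''y'' Sub ''x'' ''n'' ;; Load ''c'' ''v'' ''y'')"

definition ask_query :: "dyn_alg \<Rightarrow> com" where
  "ask_query A = rename tag (dyn_query A) ;; Bin ''answer'' Less ''0'' (tag ''answer'')"

definition reduction_round :: "dyn_alg \<Rightarrow> com" where
  "reduction_round A = flip_spokes A read_joint_vector ;; ask_query A ;;
     flip_spokes A (read_joint_vector ;; Bin ''c'' Eq ''c'' ''0'') ;; flip_spokes A (Const ''c'' 1)"

definition set_constants :: com where
  "set_constants = Const ''1'' 1 ;; Bin ''2n'' Add ''n'' ''n'' ;; Bin ''3n'' Add ''2n'' ''n'' ;;
     Bin ''nn'' Mul ''n'' ''n'' ;; Bin ''2n+1'' Add ''2n'' ''1'' ;;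
     Bin ''4n+1'' Add ''2n'' ''2n+1'' ;; Bin ''T'' Mul ''n'' ''4n+1'' ;; Bin ''T'' Add ''nn'' ''T''"

definition matrix_entry :: com where
  "matrix_entry = Bin ''a'' Div ''x'' ''n'' ;; Bin ''b'' Mod ''x'' ''n'' ;;
     Load ''c'' ''M'' ''x'' ;; If ''c'' (Bin ''b'' Add ''n'' ''b'') (Bin ''b'' Add ''2n'' ''b'')"

text \<open>
  Position \<open>n\<^sup>2 + i\<close> of the prediction is a query iff \<open>i mod (4n + 1) mod (2n + 1) = 2n\<close>. Queries
  are encoded by zeros in all three arrays, so the endpoints are multiplied by the kind \<open>k\<close>.
\<close>

definition predicted_request :: com where
  "predicted_request = Bin ''k'' Less ''x'' ''nn'' ;;
     If ''k'' matrix_entry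
       (Bin ''a'' Sub ''x'' ''nn'' ;; Bin ''a'' Mod ''a'' ''4n+1'' ;;
        Bin ''a'' Mod ''a'' ''2n+1'' ;; Bin ''k'' Less ''a'' ''2n'' ;;
        Bin ''a'' Mul ''a'' ''k'' ;; Bin ''b'' Mul ''3n'' ''k'')"

definition write_request :: com where
  "write_request =
     Store (tag ''kind'') ''x'' ''k'' ;; Store (tag ''fst'') ''x'' ''a'' ;;
     Store (tag ''snd'') ''x'' ''b''"

definition set_parameters :: com where
  "set_parameters =
     Bin (tag ''n'') Add ''3n'' ''1'' ;; Bin (tag ''s'') Add ''3n'' ''0'' ;;
     Bin (tag ''T'') Add ''T'' ''0''"

definition reduction_prep :: "dyn_alg \<Rightarrow> com" where
  "reduction_prep A = set_constants ;; for_loop ''T'' (predicted_request ;; write_request) ;;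
     set_parameters ;; rename tag (dyn_prep A) ;;
     for_loop ''nn'' (matrix_entry ;; call_update A ''a'' ''b'')"

definition reduction :: "dyn_alg \<Rightarrow> oumv_alg" where
  "reduction A = \<lparr>oumv_prep = reduction_prep A, oumv_round = reduction_round A\<rparr>"

abbreviation request_kind :: "request \<Rightarrow> nat" where
  "request_kind \<equiv> \<lambda>r. case r of Update u v \<Rightarrow> 1 | Query \<Rightarrow> 0"

abbreviation request_fst :: "request \<Rightarrow> nat" where
  "request_fst \<equiv> \<lambda>r. case r of Update u v \<Rightarrow> u | Query \<Rightarrow> 0"

abbreviation request_snd :: "request \<Rightarrow> nat" where
  "request_snd \<equiv> \<lambda>r. case r of Update u v \<Rightarrow> v | Query \<Rightarrow> 0"

definition request_store :: "request list \<Rightarrow> bool stream \<Rightarrow> store" where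
  "request_store \<rho> \<omega> = (zero_store \<omega>)
     \<lparr>arr := (\<lambda>_ _. 0)(''kind'' := request_array request_kind \<rho>,
        ''fst'' := request_array request_fst \<rho>, ''snd'' := request_array request_snd \<rho>)\<rparr>"

lemma request_array_snoc: "request_array f (\<rho> @ [r]) = (request_array f \<rho>)(length \<rho> := f r)"
  by (auto simp: request_array_def fun_eq_iff nth_append)

definition request_loaded :: "request \<Rightarrow> store \<Rightarrow> bool" where
  "request_loaded r \<tau> \<longleftrightarrow> reg \<tau> ''k'' = request_kind r \<and> reg \<tau> ''a'' = request_fst r \<and>
     reg \<tau> ''b'' = request_snd r"

definition dyn_input_size :: "nat \<Rightarrow> nat" where
  "dyn_input_size n = 3 * n + 1 + prediction_length n + 2"

definition round_time :: "nat \<Rightarrow> real \<Rightarrow> real \<Rightarrow> real" where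
  "round_time n U Q = 6 * n * (U + 11) + Q + 10"

definition prep_overhead :: "nat \<Rightarrow> real \<Rightarrow> real" where
  "prep_overhead n U = n * n * (U + 10) + 14 * real (prediction_length n) + 17"

locale simulation =
  fixes A :: dyn_alg and W W' n :: nat and M :: bool_mat and U Q :: real
  assumes word_size_le: "W \<le> W'"
    and input_size_le: "dyn_input_size n \<le> W'"
    and U_nonneg: "0 \<le> U"
begin

lemma word_size_bounds: "prediction_length n \<le> W'" "n * n + n * (4 * n + 1) + 3 * n + 1 \<le> W'"
  using input_size_le unfolding dyn_input_size_def prediction_length_def by linarith+

definition workspace ::
  "bool_vec \<Rightarrow> bool_vec \<Rightarrow> nat \<Rightarrow> (store \<Rightarrow> bool) \<Rightarrow> store \<Rightarrow> bool" where
  "workspace u v a R \<tau> \<longleftrightarrow>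
     reg \<tau> ''0'' = 0 \<and> reg \<tau> ''1'' = 1 \<and> reg \<tau> ''n'' = n \<and> reg \<tau> ''2n'' = 2 * n \<and>
     reg \<tau> ''3n'' = 3 * n \<and> reg \<tau> ''nn'' = n * n \<and> reg \<tau> ''2n+1'' = 2 * n + 1 \<and>
     reg \<tau> ''4n+1'' = 4 * n + 1 \<and> reg \<tau> ''T'' = prediction_length n \<and>
     arr \<tau> ''M'' = mat_array n M \<and> arr \<tau> ''u'' = vec_array n u \<and> arr \<tau> ''v'' = vec_array n v \<and>
     reg \<tau> ''answer'' = a \<and> R (hidden \<tau>)"

abbreviation serving ::
  "bool_vec \<Rightarrow> bool_vec \<Rightarrow> nat \<Rightarrow> request list \<Rightarrow> nat list \<Rightarrow> store \<Rightarrow> bool" where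
  "serving u v a \<rho> as \<equiv> workspace u v a (serves A W U Q \<rho> as)"

abbreviation answered ::
  "bool_vec \<Rightarrow> bool_vec \<Rightarrow> request list \<Rightarrow> nat list \<Rightarrow> store \<Rightarrow> bool" where
  "answered u v \<rho> as \<tau> \<equiv> \<exists>b as'. as = b # as' \<and> serving u v (of_bool (0 < b)) \<rho> as' \<tau>"

lemma hoare_hidden:
  assumes "hoare W P c k R" and frame: "\<And>\<tau> \<sigma>. F \<tau> \<Longrightarrow> F (embed_store tag \<tau> \<sigma>)"
  shows "hoare W' (\<lambda>\<tau>. workspace u v a P \<tau> \<and> F \<tau>) (rename tag c) k
    (\<lambda>\<tau>. workspace u v a R \<tau> \<and> F \<tau>)"
  by (rule hoare_conseq[OF hoare_rename[OF assms(1) inj_tag word_size_le,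
        of "\<lambda>\<tau>. workspace u v a (\<lambda>_. True) \<tau> \<and> F \<tau>"]])
    (use frame in \<open>auto simp: workspace_def\<close>)

lemma hoare_call_update:
  assumes "z \<notin> range tag"
  shows "hoare W'
    (\<lambda>\<tau>. serving u v a (Update p q # \<rho>) as \<tau> \<and> reg \<tau> ''x'' = i \<and>
       reg \<tau> y = p \<and> reg \<tau> z = q \<and> p \<le> W' \<and> q \<le> W')
    (call_update A y z) (U + 2)
    (\<lambda>\<tau>. serving u v a \<rho> as \<tau> \<and> reg \<tau> ''x'' = i)"
proof -
  let ?ready = "terminates_within W (dyn_update A) U (serves A W U Q \<rho> as)"
  have z_untouched: "z \<noteq> tag ''u''" using assms by auto
  have "hoare W'
    (\<lambda>\<tau>. serving u v a (Update p q # \<rho>) as \<tau> \<and> reg \<tau> ''x'' = i \<and>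
       reg \<tau> y = p \<and> reg \<tau> z = q \<and> p \<le> W' \<and> q \<le> W')
    (Bin (tag ''u'') Add y ''0'' ;; Bin (tag ''v'') Add z ''0'') 2
    (\<lambda>\<tau>. workspace u v a ?ready \<tau> \<and> reg \<tau> ''x'' = i)"
    by (rule hoare_wpI)
      (use z_untouched in \<open>auto simp: workspace_def restrict_store_def update_input_def\<close>)
  from hoare_Seq[OF this hoare_hidden[OF hoare_terminates_within]] show ?thesis
    by (simp add: call_update_def hoare_Seq_assoc add.commute)
qed

lemma hoare_flip_spokes:
  assumes guard: "\<And>i R. i < 2 * n \<Longrightarrow> hoare W' (\<lambda>\<tau>. workspace u v a R \<tau> \<and> reg \<tau> ''x'' = i) g 5
      (\<lambda>\<tau>. workspace u v a R \<tau> \<and> reg \<tau> ''x'' = i \<and> (reg \<tau> ''c'' \<noteq> 0 \<longleftrightarrow> P i))"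
  shows "hoare W' (serving u v a (updates (spokes n P) @ \<rho>) as)
    (flip_spokes A g) (2 * n * (U + 11) + 3) (serving u v a \<rho> as)"
proof -
  define rest where "rest i = updates (map (\<lambda>x. (x, 3 * n)) (filter P [i..<2 * n])) @ \<rho>" for i
  define J where "J i = serving u v a (rest i) as" for i
  have step: "hoare W' (\<lambda>\<tau>. J i \<tau> \<and> reg \<tau> ''x'' = i)
      (g ;; If ''c'' (call_update A ''x'' ''3n'') Skip)
      (5 + (U + 2 + 1)) (\<lambda>\<tau>. J (Suc i) \<tau> \<and> reg \<tau> ''x'' = i)" if i: "i < 2 * n" for i
    unfolding J_def
  proof (rule hoare_Seq[OF guard[OF i] hoare_If])
    have rest_eq: "rest i = (if P i then Update i (3 * n) # rest (Suc i) else rest (Suc i))"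
      using i by (simp add: rest_def updates_def upt_conv_Cons)
    show "hoare W' (\<lambda>\<tau>. (serving u v a (rest i) as \<tau> \<and> reg \<tau> ''x'' = i \<and>
        (reg \<tau> ''c'' \<noteq> 0 \<longleftrightarrow> P i)) \<and> reg \<tau> ''c'' \<noteq> 0)
      (call_update A ''x'' ''3n'') (U + 2)
      (\<lambda>\<tau>. serving u v a (rest (Suc i)) as \<tau> \<and> reg \<tau> ''x'' = i)"
      by (rule hoare_conseq[OF hoare_call_update[of _ _ _ _ i "3 * n" "rest (Suc i)" as i]])
        (use i rest_eq word_size_bounds in \<open>auto simp: workspace_def\<close>)
    show "hoare W' (\<lambda>\<tau>. (serving u v a (rest i) as \<tau> \<and> reg \<tau> ''x'' = i \<and>
        (reg \<tau> ''c'' \<noteq> 0 \<longleftrightarrow> P i)) \<and> reg \<tau> ''c'' = 0)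
      Skip (U + 2) (\<lambda>\<tau>. serving u v a (rest (Suc i)) as \<tau> \<and> reg \<tau> ''x'' = i)"
      by (rule hoare_wpI) (use rest_eq U_nonneg in auto)
  qed
  have "hoare W' (J 0) (flip_spokes A g) (real (2 * n) * (5 + (U + 2 + 1) + 3) + 3) (J (2 * n))"
    unfolding flip_spokes_def
    by (rule hoare_for_loop[OF step])
      (use word_size_bounds in \<open>auto simp: J_def workspace_def restrict_store_def\<close>)
  then show ?thesis
    by (rule hoare_conseq) (auto simp: J_def rest_def spokes_def updates_def algebra_simps)
qed

lemma hoare_read_joint_vector:
  assumes "i < 2 * n"
  shows "hoare W' (\<lambda>\<tau>. workspace u v a R \<tau> \<and> reg \<tau> ''x'' = i) read_joint_vector 4
    (\<lambda>\<tau>. workspace u v a R \<tau> \<and> reg \<tau> ''x'' = i \<and> reg \<tau> ''c'' = of_bool (joint_vector n u v i))"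
  unfolding read_joint_vector_def
  by (rule hoare_wpI) (use assms word_size_bounds in
    \<open>auto simp: workspace_def restrict_store_def vec_array_def joint_vector_def less_diff_conv2\<close>)

lemma hoare_flip_selected:
  "hoare W' (serving u v a (updates (spokes n (joint_vector n u v)) @ \<rho>) as)
    (flip_spokes A read_joint_vector) (2 * n * (U + 11) + 3) (serving u v a \<rho> as)"
  by (rule hoare_flip_spokes, rule hoare_conseq[OF hoare_read_joint_vector]) auto

lemma hoare_flip_unselected:
  "hoare W'
    (serving u v a (updates (spokes n (\<lambda>x. \<not> joint_vector n u v x)) @ \<rho>) as)
    (flip_spokes A (read_joint_vector ;; Bin ''c'' Eq ''c'' ''0'')) (2 * n * (U + 11) + 3)
    (serving u v a \<rho> as)"
proof (rule hoare_flip_spokes)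
  fix i R assume i: "i < 2 * n"
  let ?P = "joint_vector n u v"
  have "hoare W' (\<lambda>\<tau>. workspace u v a R \<tau> \<and> reg \<tau> ''x'' = i \<and> reg \<tau> ''c'' = of_bool (?P i))
      (Bin ''c'' Eq ''c'' ''0'') 1
      (\<lambda>\<tau>. workspace u v a R \<tau> \<and> reg \<tau> ''x'' = i \<and> (reg \<tau> ''c'' \<noteq> 0 \<longleftrightarrow> \<not> ?P i))"
    by (rule hoare_wpI) (use word_size_bounds in \<open>auto simp: workspace_def restrict_store_def\<close>)
  from hoare_Seq[OF hoare_read_joint_vector[OF i] this]
  show "hoare W' (\<lambda>\<tau>. workspace u v a R \<tau> \<and> reg \<tau> ''x'' = i)
      (read_joint_vector ;; Bin ''c'' Eq ''c'' ''0'') 5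
      (\<lambda>\<tau>. workspace u v a R \<tau> \<and> reg \<tau> ''x'' = i \<and> (reg \<tau> ''c'' \<noteq> 0 \<longleftrightarrow> \<not> ?P i))"
    by simp
qed

lemma hoare_flip_all:
  "hoare W' (serving u v a (updates (spokes n (\<lambda>_. True)) @ \<rho>) as)
    (flip_spokes A (Const ''c'' 1)) (2 * n * (U + 11) + 3) (serving u v a \<rho> as)"
  by (rule hoare_flip_spokes, rule hoare_wpI)
    (use word_size_bounds in \<open>auto simp: workspace_def restrict_store_def\<close>)

lemma hoare_ask_query:
  "hoare W' (serving u v a (Query # \<rho>) as) (ask_query A) (Q + 1) (answered u v \<rho> as)"
proof -
  let ?R = "\<lambda>\<sigma>. \<exists>as'. as = reg \<sigma> ''answer'' # as' \<and> serves A W U Q \<rho> as' \<sigma>"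
  have query: "hoare W' (serving u v a (Query # \<rho>) as) (rename tag (dyn_query A)) Q
      (workspace u v a ?R)"
    by (rule hoare_conseq[OF hoare_hidden[OF hoare_terminates_within, of "\<lambda>_. True"]])
      (auto simp: workspace_def)
  have "hoare W' (workspace u v a ?R) (Bin ''answer'' Less ''0'' (tag ''answer'')) 1
      (answered u v \<rho> as)"
    by (rule hoare_wpI) (use word_size_bounds in \<open>auto simp: workspace_def restrict_store_def\<close>)
  from hoare_Seq[OF query this] show ?thesis by (simp add: ask_query_def)
qed

lemma hoare_reduction_round:
  "hoare W' (serving u v a (round_requests n u v @ \<rho>) as) (reduction_round A) (round_time n U Q)
    (answered u v \<rho> as)"
proof -
  let ?rest =
    "updates (spokes n (\<lambda>x. \<not> joint_vector n u v x)) @ updates (spokes n (\<lambda>_. True)) @ \<rho>"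
  note restore = hoare_Seq[OF hoare_flip_unselected hoare_flip_all]
  have "hoare W' (answered u v ?rest as)
      (flip_spokes A (read_joint_vector ;; Bin ''c'' Eq ''c'' ''0'') ;;
       flip_spokes A (Const ''c'' 1))
      (2 * n * (U + 11) + 3 + (2 * n * (U + 11) + 3)) (answered u v \<rho> as)"
    using restore unfolding hoare_def by (fastforce intro: terminates_within_mono[OF _ order.refl])
  from hoare_Seq[OF hoare_flip_selected hoare_Seq[OF hoare_ask_query this]] show ?thesis
    unfolding reduction_round_def
    by (rule hoare_conseq) (auto simp: round_requests_def round_time_def algebra_simps)
qed

lemma workspace_oumv_input:
  "workspace u v a R \<tau> \<Longrightarrow> workspace u' v' a R (oumv_input n u' v' \<tau>)"
  by (simp add: workspace_def oumv_input_def restrict_store_def)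

lemma reduction_answers_rounds:
  assumes "serving u v a (online_requests n uvs) as \<tau>"
  shows "\<exists>t. oumv_rounds (reduction A) W' n \<tau> uvs t (map (\<lambda>b. of_bool (0 < b)) as) \<and>
    real t \<le> length uvs * round_time n U Q"
  using assms
proof (induction uvs arbitrary: u v a \<tau> as)
  case Nil
  then have "as = []" by (simp add: workspace_def)
  then show ?case by (auto intro: oumv_rounds.Nil)
next
  case (Cons uv uvs)
  obtain u' v' where uv_eq: "uv = (u', v')" by (cases uv)
  have "serving u' v' a (round_requests n u' v' @ online_requests n uvs) as
      (oumv_input n u' v' \<tau>)"
    using workspace_oumv_input[OF Cons.prems] by (simp add: uv_eq)
  from hoare_reduction_round[unfolded hoare_def, rule_format, OF this] obtain t \<tau>' b as' where
    first: "exec W' (reduction_round A) (oumv_input n u' v' \<tau>) t \<tau>'"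
      "real t \<le> round_time n U Q" "as = b # as'" and
    rest: "serving u' v' (of_bool (0 < b)) (online_requests n uvs) as' \<tau>'"
    unfolding terminates_within_def by blast
  have answer: "reg \<tau>' ''answer'' = of_bool (0 < b)" using rest by (simp add: workspace_def)
  from Cons.IH[OF rest] obtain t' where
    "oumv_rounds (reduction A) W' n \<tau>' uvs t' (map (\<lambda>b. of_bool (0 < b)) as')"
    "real t' \<le> length uvs * round_time n U Q" by blast
  moreover from this(1) have
    "oumv_rounds (reduction A) W' n \<tau> (uv # uvs) (t + t') (map (\<lambda>b. of_bool (0 < b)) as)"
    using oumv_rounds.Cons[of W' "reduction A" n u' v' \<tau> t \<tau>'] first
    by (simp add: reduction_def uv_eq answer)
  ultimately show ?case using first(2) by (intro exI[of _ "t + t'"]) (simp add: algebra_simps)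
qed

abbreviation blank_workspace :: "(store \<Rightarrow> bool) \<Rightarrow> store \<Rightarrow> bool" where
  "blank_workspace \<equiv> workspace (\<lambda>_. False) (\<lambda>_. False) 0"

lemma hoare_set_constants:
  "hoare W' (\<lambda>\<tau>. \<tau> = oumv_init n M \<omega>) set_constants 8
    (blank_workspace (\<lambda>\<sigma>. \<sigma> = request_store [] \<omega>))"
proof (rule hoare_wpI)
  fix \<tau> assume init: "\<tau> = oumv_init n M \<omega>"
  have "request_array f [] = (\<lambda>_. 0)" for f by (simp add: request_array_def)
  moreover have "(\<lambda>_. c) \<circ> tag = (\<lambda>_. c)" for c by auto
  moreover have "(\<lambda>_ (_ :: nat). 0 :: nat)(x := \<lambda>_. 0) = (\<lambda>_ _. 0)" for x :: name by auto
  ultimately show "wp W' set_constants (\<lambda>t \<tau>'. real t \<le> 8 \<and>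
      blank_workspace (\<lambda>\<sigma>. \<sigma> = request_store [] \<omega>) \<tau>') 0 \<tau>"
    using word_size_bounds
    by (simp add: init set_constants_def oumv_init_def workspace_def restrict_store_def
        request_store_def zero_store_def vec_array_def prediction_length_def algebra_simps)
qed

lemma hoare_matrix_entry:
  assumes "i < n * n"
  shows "hoare W' (\<lambda>\<tau>. workspace u v a R \<tau> \<and> reg \<tau> ''x'' = i) matrix_entry 5
    (\<lambda>\<tau>. workspace u v a R \<tau> \<and> reg \<tau> ''x'' = i \<and>
       (reg \<tau> ''a'', reg \<tau> ''b'') = matrix_edges n M ! i)"
  unfolding matrix_entry_def
  by (rule hoare_wpI) (use assms div_mod_less_square[OF assms] word_size_bounds in
    \<open>auto simp: nth_matrix_edges workspace_def restrict_store_def mat_array_def\<close>)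

lemma hoare_predicted_request:
  assumes i: "i < prediction_length n"
  shows "hoare W' (\<lambda>\<tau>. workspace u v a R \<tau> \<and> reg \<tau> ''x'' = i) predicted_request 8
    (\<lambda>\<tau>. workspace u v a R \<tau> \<and> reg \<tau> ''x'' = i \<and> request_loaded (prediction n M ! i) \<tau>)"
proof (cases "i < n * n")
  case True
  then show ?thesis
    unfolding predicted_request_def matrix_entry_def
    by (intro hoare_wpI) (use i div_mod_less_square[OF True] word_size_bounds in
      \<open>auto simp: nth_prediction nth_matrix_edges workspace_def restrict_store_def mat_array_def
        request_loaded_def\<close>)
next
  case False
  define x where "x = (i - n * n) mod (4 * n + 1) mod (2 * n + 1)"
  have "(i - n * n) mod (4 * n + 1) \<le> W'" "x \<le> W'" "i - n * n \<le> W'"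
    using i[unfolded prediction_length_def] word_size_bounds
      mod_less_eq_dividend[of "i - n * n" "4 * n + 1"]
      mod_less_eq_dividend[of "(i - n * n) mod (4 * n + 1)" "2 * n + 1"]
    unfolding x_def by linarith+
  moreover have "prediction n M ! i = (if x < 2 * n then Update x (3 * n) else Query)"
    using False i by (simp add: nth_prediction x_def Let_def)
  ultimately show ?thesis
    unfolding predicted_request_def
    by (intro hoare_wpI) (use False word_size_bounds in
      \<open>auto simp: workspace_def restrict_store_def request_loaded_def x_def[symmetric]
        simp del: One_nat_def\<close>)
qed

lemma hoare_write_request:
  "hoare W' (\<lambda>\<tau>. workspace u v a (\<lambda>\<sigma>. \<sigma> = request_store \<rho> \<omega>) \<tau> \<and> reg \<tau> ''x'' = length \<rho> \<and>
      request_loaded r \<tau>)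
    write_request 3
    (\<lambda>\<tau>. workspace u v a (\<lambda>\<sigma>. \<sigma> = request_store (\<rho> @ [r]) \<omega>) \<tau> \<and> reg \<tau> ''x'' = length \<rho>)"
proof (rule hoare_wpI)
  fix \<tau> assume pre: "workspace u v a (\<lambda>\<sigma>. \<sigma> = request_store \<rho> \<omega>) \<tau> \<and> reg \<tau> ''x'' = length \<rho> \<and>
      request_loaded r \<tau>"
  then have hidden: "reg \<tau> \<circ> tag = reg (request_store \<rho> \<omega>)"
    "arr \<tau> \<circ> tag = arr (request_store \<rho> \<omega>)" "coins \<tau> = coins (request_store \<rho> \<omega>)"
    by (auto simp: workspace_def restrict_store_def dest: arg_cong[of _ _ reg] arg_cong[of _ _ arr]
        arg_cong[of _ _ coins])
  from fun_cong[OF hidden(2)] have "arr \<tau> (tag x) = arr (request_store \<rho> \<omega>) x" for x by simp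
  with pre hidden show "wp W' write_request (\<lambda>t \<tau>'. real t \<le> 3 \<and>
      workspace u v a (\<lambda>\<sigma>. \<sigma> = request_store (\<rho> @ [r]) \<omega>) \<tau>' \<and> reg \<tau>' ''x'' = length \<rho>) 0 \<tau>"
    by (simp add: write_request_def workspace_def restrict_store_def request_loaded_def)
      (simp add: request_store_def request_array_snoc zero_store_def fun_upd_twist)
qed

lemma hoare_write_prediction:
  "hoare W' (blank_workspace (\<lambda>\<sigma>. \<sigma> = request_store [] \<omega>))
    (for_loop ''T'' (predicted_request ;; write_request)) (14 * real (prediction_length n) + 3)
    (blank_workspace (\<lambda>\<sigma>. \<sigma> = request_store (prediction n M) \<omega>))"
proof -
  define J where "J i = blank_workspace (\<lambda>\<sigma>. \<sigma> = request_store (take i (prediction n M)) \<omega>)" for i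
  have "hoare W' (\<lambda>\<tau>. J i \<tau> \<and> reg \<tau> ''x'' = i) (predicted_request ;; write_request) (8 + 3)
      (\<lambda>\<tau>. J (Suc i) \<tau> \<and> reg \<tau> ''x'' = i)" if i: "i < prediction_length n" for i
  proof -
    have "hoare W' (\<lambda>\<tau>. J i \<tau> \<and> reg \<tau> ''x'' = i \<and> request_loaded (prediction n M ! i) \<tau>)
        write_request 3 (\<lambda>\<tau>. J (Suc i) \<tau> \<and> reg \<tau> ''x'' = i)"
      using hoare_write_request[where \<rho> = "take i (prediction n M)" and r = "prediction n M ! i"] i
      by (simp add: J_def length_prediction take_Suc_conv_app_nth)
    with hoare_predicted_request[OF i] show ?thesis
      unfolding J_def by (rule hoare_Seq)
  qed
  then have "hoare W' (J 0) (for_loop ''T'' (predicted_request ;; write_request))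
      (real (prediction_length n) * (8 + 3 + 3) + 3) (J (prediction_length n))"
    by (rule hoare_for_loop)
      (use word_size_bounds in \<open>auto simp: J_def workspace_def restrict_store_def\<close>)
  then show ?thesis
    by (rule hoare_conseq) (auto simp: J_def length_prediction)
qed

lemma hoare_set_parameters:
  "hoare W' (blank_workspace (\<lambda>\<sigma>. \<sigma> = request_store (prediction n M) \<omega>)) set_parameters 3
    (blank_workspace (\<lambda>\<sigma>. \<sigma> = dyn_init (3 * n + 1) (3 * n) (prediction n M) \<omega>))"
proof (rule hoare_wpI)
  fix \<tau> assume pre: "blank_workspace (\<lambda>\<sigma>. \<sigma> = request_store (prediction n M) \<omega>) \<tau>"
  then have "reg \<tau> \<circ> tag = (\<lambda>_. 0)" "arr \<tau> \<circ> tag = arr (request_store (prediction n M) \<omega>)"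
    "coins \<tau> = \<omega>"
    by (auto simp: workspace_def restrict_store_def request_store_def zero_store_def)
  with pre word_size_bounds show "wp W' set_parameters (\<lambda>t \<tau>'. real t \<le> 3 \<and>
      blank_workspace (\<lambda>\<sigma>. \<sigma> = dyn_init (3 * n + 1) (3 * n) (prediction n M) \<omega>) \<tau>') 0 \<tau>"
    by (simp add: set_parameters_def workspace_def restrict_store_def)
      (simp add: request_store_def dyn_init_def zero_store_def length_prediction)
qed

lemma hoare_insert_matrix:
  "hoare W' (serving u v a (updates (matrix_edges n M) @ \<rho>) as)
    (for_loop ''nn'' (matrix_entry ;; call_update A ''a'' ''b'')) (n * n * (U + 10) + 3)
    (serving u v a \<rho> as)"
proof -
  define rest where "rest i = updates (drop i (matrix_edges n M)) @ \<rho>" for i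
  define J where "J i = serving u v a (rest i) as" for i
  have "hoare W' (\<lambda>\<tau>. J i \<tau> \<and> reg \<tau> ''x'' = i) (matrix_entry ;; call_update A ''a'' ''b'')
      (5 + (U + 2)) (\<lambda>\<tau>. J (Suc i) \<tau> \<and> reg \<tau> ''x'' = i)" if i: "i < n * n" for i
  proof -
    obtain p q where entry_eq: "matrix_edges n M ! i = (p, q)" by (cases "matrix_edges n M ! i")
    have entry: "hoare W' (\<lambda>\<tau>. J i \<tau> \<and> reg \<tau> ''x'' = i) matrix_entry 5
        (\<lambda>\<tau>. J i \<tau> \<and> reg \<tau> ''x'' = i \<and> reg \<tau> ''a'' = p \<and> reg \<tau> ''b'' = q)"
      unfolding J_def by (rule hoare_conseq[OF hoare_matrix_entry[OF i]]) (auto simp: entry_eq)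
    have args_fit: "p \<le> W'" "q \<le> W'"
      using nth_matrix_edges[OF i, of M] div_mod_less_square[OF i] word_size_bounds
      by (auto simp: entry_eq split: if_splits)
    have "rest i = Update p q # rest (Suc i)"
      using i entry_eq
      by (simp add: rest_def updates_def length_matrix_edges Cons_nth_drop_Suc[symmetric])
    then have "hoare W' (\<lambda>\<tau>. J i \<tau> \<and> reg \<tau> ''x'' = i \<and> reg \<tau> ''a'' = p \<and> reg \<tau> ''b'' = q)
        (call_update A ''a'' ''b'') (U + 2) (\<lambda>\<tau>. J (Suc i) \<tau> \<and> reg \<tau> ''x'' = i)"
      unfolding J_def
      by (intro hoare_conseq[OF hoare_call_update[of _ _ _ _ p q "rest (Suc i)" as i]])
        (use args_fit in auto)
    with entry show ?thesis by (rule hoare_Seq)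
  qed
  then have "hoare W' (J 0) (for_loop ''nn'' (matrix_entry ;; call_update A ''a'' ''b''))
      (real (n * n) * (5 + (U + 2) + 3) + 3) (J (n * n))"
    by (rule hoare_for_loop)
      (use word_size_bounds in \<open>auto simp: J_def workspace_def restrict_store_def\<close>)
  then show ?thesis
    by (rule hoare_conseq) (auto simp: J_def rest_def updates_def length_matrix_edges algebra_simps)
qed

lemma hoare_reduction_prep:
  assumes "terminates_within W (dyn_prep A) p (serves A W U Q (requests n M uvs) as)
    (dyn_init (3 * n + 1) (3 * n) (prediction n M) \<omega>)"
  shows "hoare W' (\<lambda>\<tau>. \<tau> = oumv_init n M \<omega>) (reduction_prep A) (p + prep_overhead n U)
    (blank_workspace (serves A W U Q (online_requests n uvs) as))"
proof -
  have prep: "hoare W'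
      (blank_workspace (\<lambda>\<sigma>. \<sigma> = dyn_init (3 * n + 1) (3 * n) (prediction n M) \<omega>))
      (rename tag (dyn_prep A)) p (blank_workspace (serves A W U Q (requests n M uvs) as))"
    by (rule hoare_conseq[OF hoare_hidden[OF hoare_terminates_within, of "\<lambda>_. True"]])
      (use assms in \<open>auto simp: workspace_def\<close>)
  note steps = hoare_Seq[OF hoare_set_constants
      hoare_Seq[OF hoare_write_prediction
        hoare_Seq[OF hoare_set_parameters
          hoare_Seq[OF prep[unfolded requests_def] hoare_insert_matrix]]]]
  show ?thesis
    unfolding reduction_prep_def
    by (rule hoare_conseq[OF steps]) (auto simp: prep_overhead_def)
qed

lemma reduction_run:
  assumes "terminates_within W (dyn_prep A) p (serves A W U Q (requests n M uvs) as)
    (dyn_init (3 * n + 1) (3 * n) (prediction n M) \<omega>)"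
  shows "\<exists>p' t. oumv_run (reduction A) W' n M uvs \<omega> p' t (map (\<lambda>b. of_bool (0 < b)) as) \<and>
    real p' \<le> p + prep_overhead n U \<and> real t \<le> length uvs * round_time n U Q"
proof -
  obtain p' \<tau> where prep: "exec W' (reduction_prep A) (oumv_init n M \<omega>) p' \<tau>"
    "real p' \<le> p + prep_overhead n U"
    "blank_workspace (serves A W U Q (online_requests n uvs) as) \<tau>"
    using hoare_reduction_prep[OF assms] by (auto simp: hoare_def terminates_within_def)
  with reduction_answers_rounds[OF prep(3)] show ?thesis
    by (auto simp: oumv_run_def reduction_def)
qed

end

lemma dyn_run_imp_serves:
  assumes "dyn_run A W n s \<rho>' \<rho> \<omega> p ts as"
    and "\<forall>i<length \<rho>. real (ts ! i) \<le> request_time U Q (\<rho> ! i)"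
  shows "terminates_within W (dyn_prep A) p (serves A W U Q \<rho> as) (dyn_init n s \<rho>' \<omega>)"
  using assms dyn_serve_imp_serves unfolding dyn_run_def terminates_within_def by blast

text \<open>A run with correct answers need not respect the time bounds; its budget is read off the run.\<close>

lemma dyn_run_imp_ex_serves:
  assumes "dyn_run A W n s \<rho>' \<rho> \<omega> p ts as"
  shows "\<exists>B\<ge>0. terminates_within W (dyn_prep A) p (serves A W B B \<rho> as) (dyn_init n s \<rho>' \<omega>)"
proof (intro exI conjI)
  show "terminates_within W (dyn_prep A) p (serves A W (sum_list ts) (sum_list ts) \<rho> as)
      (dyn_init n s \<rho>' \<omega>)"
  proof (rule dyn_run_imp_serves[OF assms], intro allI impI)
    fix i assume "i < length \<rho>"
    moreover have "length ts = length \<rho>" using assms dyn_serve_length by (auto simp: dyn_run_def)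
    ultimately have "ts ! i \<le> sum_list ts" by (intro member_le_sum_list) auto
    then show "real (ts ! i) \<le> request_time (sum_list ts) (sum_list ts) (\<rho> ! i)"
      by (auto simp: request_time_def split: request.split)
  qed
qed simp

lemma reduction_success_probability:
  assumes word_size: "W \<le> W'" "dyn_input_size n \<le> W'"
  shows "measure fair_coins {\<omega>. \<exists>p ts. dyn_run A W (3 * n + 1) (3 * n) (prediction n M)
      (requests n M uvs) \<omega> p ts (correct_answers (3 * n + 1) (3 * n) {} (requests n M uvs))} \<le>
    measure fair_coins {\<omega>. \<exists>p t. oumv_run (reduction A) W' n M uvs \<omega> p t
      (map (\<lambda>(u, v). of_bool (uMv n M u v)) uvs)}"
proof -
  interpret prob_space fair_coins by (rule prob_space_fair_coins)
  show ?thesis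
  proof (rule finite_measure_mono[OF subsetI oumv_success_measurable], elim CollectE exE)
    fix \<omega> p ts
    assume "dyn_run A W (3 * n + 1) (3 * n) (prediction n M) (requests n M uvs) \<omega> p ts
      (correct_answers (3 * n + 1) (3 * n) {} (requests n M uvs))"
    then obtain B where budget: "B \<ge> 0" "terminates_within W (dyn_prep A) p
      (serves A W B B (requests n M uvs)
        (correct_answers (3 * n + 1) (3 * n) {} (requests n M uvs)))
      (dyn_init (3 * n + 1) (3 * n) (prediction n M) \<omega>)"
      using dyn_run_imp_ex_serves by blast
    interpret simulation A W W' n M B B by unfold_locales (use word_size budget(1) in auto)
    show "\<omega> \<in> {\<omega>. \<exists>p t. oumv_run (reduction A) W' n M uvs \<omega> p t
        (map (\<lambda>(u, v). of_bool (uMv n M u v)) uvs)}"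
      using reduction_run[OF budget(2)] unfolding correct_answers_requests by blast
  qed
qed

definition solves_instance ::
  "dyn_alg \<Rightarrow> nat \<Rightarrow> real \<Rightarrow> real \<Rightarrow> nat \<Rightarrow> nat \<Rightarrow> request list \<Rightarrow> request list \<Rightarrow> bool" where
  "solves_instance A W U Q n s \<rho>' \<rho> \<longleftrightarrow>
     (\<forall>\<omega>. \<exists>p ts as. dyn_run A W n s \<rho>' \<rho> \<omega> p ts as \<and> p \<le> W \<and>
        (\<forall>i<length \<rho>. real (ts ! i) \<le> request_time U Q (\<rho> ! i))) \<and>
     measure fair_coins {\<omega>. \<exists>p ts. dyn_run A W n s \<rho>' \<rho> \<omega> p ts (correct_answers n s {} \<rho>)} \<ge> 2 / 3"

lemma solves_s_triangle_delayed_iff: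
  "solves_s_triangle_delayed A d U Q \<longleftrightarrow>
     (\<exists>k. \<forall>n s \<rho>' \<rho>. s < n \<longrightarrow> (\<forall>r\<in>set \<rho>'. valid_request n r) \<longrightarrow> delayed_for (d n) \<rho>' {\<rho>} \<longrightarrow>
        solves_instance A ((n + length \<rho>' + 2) ^ k) (U n) (Q n) n s \<rho>' \<rho>)"
  by (simp only: solves_s_triangle_delayed_def solves_instance_def Let_def)

lemma solves_s_triangle_delayed_nonneg:
  assumes "solves_s_triangle_delayed A d U Q" "n \<ge> 2"
  shows "U n \<ge> 0" "Q n \<ge> 0"
proof -
  have "request_time (U n) (Q n) r \<ge> 0" if r: "valid_request n r" for r
  proof -
    have "0 < n" "\<forall>r'\<in>set [r]. valid_request n r'" using assms(2) r by auto
    then obtain W where "solves_instance A W (U n) (Q n) n 0 [r] [r]"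
      using assms(1) delayed_for_refl[of "d n" "[r]"]
      unfolding solves_s_triangle_delayed_iff by blast
    then obtain ts where "real (ts ! 0) \<le> request_time (U n) (Q n) r"
      unfolding solves_instance_def by fastforce
    then show ?thesis by (meson of_nat_0_le_iff order_trans)
  qed
  from this[of "Update 0 1"] this[of Query] show "U n \<ge> 0" "Q n \<ge> 0"
    using assms(2) by (auto simp: valid_request_def request_time_def)
qed

lemma reduction_solves_instance:
  assumes solves: "solves_instance A W U Q (3 * n + 1) (3 * n) (prediction n M) (requests n M uvs)"
    and "U \<ge> 0" "W \<le> W'" "dyn_input_size n \<le> W'"
    and prep_fits: "real W + prep_overhead n U \<le> real W'"
  shows "\<exists>p t as. oumv_run (reduction A) W' n M uvs \<omega> p t as \<and> p \<le> W' \<and>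
      real t \<le> length uvs * round_time n U Q"
    and "measure fair_coins {\<omega>. \<exists>p t. oumv_run (reduction A) W' n M uvs \<omega> p t
      (map (\<lambda>(u, v). of_bool (uMv n M u v)) uvs)} \<ge> 2 / 3"
proof -
  interpret simulation A W W' n M U Q by unfold_locales fact+
  obtain p ts as where run:
    "dyn_run A W (3 * n + 1) (3 * n) (prediction n M) (requests n M uvs) \<omega> p ts as" "p \<le> W"
    "\<forall>i<length (requests n M uvs). real (ts ! i) \<le> request_time U Q (requests n M uvs ! i)"
    using solves unfolding solves_instance_def by blast
  from reduction_run[OF dyn_run_imp_serves[OF run(1,3)]] obtain p' t where
    "oumv_run (reduction A) W' n M uvs \<omega> p' t (map (\<lambda>b. of_bool (0 < b)) as)"
    "real p' \<le> p + prep_overhead n U" "real t \<le> length uvs * round_time n U Q" by blast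
  moreover from this(2) have "p' \<le> W'" using run(2) prep_fits by linarith
  ultimately show "\<exists>p t as. oumv_run (reduction A) W' n M uvs \<omega> p t as \<and> p \<le> W' \<and>
      real t \<le> length uvs * round_time n U Q" by blast
  show "measure fair_coins {\<omega>. \<exists>p t. oumv_run (reduction A) W' n M uvs \<omega> p t
      (map (\<lambda>(u, v). of_bool (uMv n M u v)) uvs)} \<ge> 2 / 3"
    using solves reduction_success_probability[OF word_size_le input_size_le, of A M uvs]
    unfolding solves_instance_def by linarith
qed

subsection \<open>Running times\<close>

lemma bigo_powr_mono: "a \<le> b \<Longrightarrow> (\<lambda>n. real n powr a) \<in> O(\<lambda>n. real n powr b)"
  by (simp add: powr_bigo_iff[OF filterlim_real_sequentially])

lemma strictly_below_power_bigo:
  assumes "strictly_below_power f c" "\<forall>\<^sub>F n in sequentially. f n \<ge> 0" "\<delta> > 0"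
  obtains \<epsilon> where "0 < \<epsilon>" "\<epsilon> \<le> \<delta>" "f \<in> O(\<lambda>n. real n powr (c - \<epsilon>))"
proof -
  obtain C \<epsilon> where "\<epsilon> > 0" and below: "\<forall>\<^sub>F n in sequentially. f n \<le> C * real n powr (c - \<epsilon>)"
    using assms(1) unfolding strictly_below_power_def by blast
  have "\<forall>\<^sub>F n in sequentially. norm (f n) \<le> C * norm (real n powr (c - \<epsilon>))"
    using below assms(2) by eventually_elim simp
  then have "f \<in> O(\<lambda>n. real n powr (c - \<epsilon>))" by (rule bigoI)
  then have "f \<in> O(\<lambda>n. real n powr (c - min \<epsilon> \<delta>))"
    by (rule landau_o.big_trans) (simp add: bigo_powr_mono)
  then show ?thesis using \<open>\<epsilon> > 0\<close> assms(3) by (intro that[of "min \<epsilon> \<delta>"]) auto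
qed

lemma bigo_powr_reindex_affine:
  assumes "f \<in> O(\<lambda>n. real n powr c)" "c \<ge> 0" "a > 0"
  shows "(\<lambda>n. f (a * n + b)) \<in> O(\<lambda>n. real n powr c)"
proof -
  have "filterlim (\<lambda>n. a * n + b) at_top sequentially"
    using assms(3) by (intro filterlim_subseq) (auto simp: strict_mono_def)
  with assms(1) have "(\<lambda>n. f (a * n + b)) \<in> O(\<lambda>n. real (a * n + b) powr c)"
    by (rule landau_o.big.compose)
  moreover have "\<forall>\<^sub>F n in sequentially. norm (real (a * n + b)) \<le> real (a + b) * norm (real n)"
    using eventually_ge_at_top[of 1]
  proof eventually_elim
    case (elim n)
    then have "real b * 1 \<le> real b * real n" by (intro mult_left_mono) auto
    then show ?case by (simp add: algebra_simps)
  qed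
  then have "(\<lambda>n. real (a * n + b)) \<in> O(\<lambda>n. real n)" by (rule bigoI)
  then have "(\<lambda>n. real (a * n + b) powr c) \<in> O(\<lambda>n. real n powr c)"
    using assms(2) by (intro bigo_powr_nonneg) auto
  ultimately show ?thesis by (rule landau_o.big_trans)
qed

lemma bigo_power_imp_le_power:
  assumes "f \<in> O(\<lambda>n. real n ^ j)"
  shows "\<exists>K. \<forall>n. f n \<le> real ((n + 2) ^ K)"
proof -
  have "(\<lambda>n. real n) \<in> O(\<lambda>n. real (n + 2))" by (intro landau_o.big_mono) simp
  then have "f \<in> O(\<lambda>n. real (n + 2) ^ j)"
    using landau_o.big_trans[OF assms] landau_o.big_power by blast
  then have "(\<lambda>n. f n / real (n + 2) ^ j) \<in> O(\<lambda>_. 1)"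
    by (simp add: landau_divide_simps)
  then have "Bseq (\<lambda>n. f n / real (n + 2) ^ j)"
    by (auto simp: bigo_def Bfun_def)
  then obtain C where quotient_bounded: "\<And>n. \<bar>f n / real (n + 2) ^ j\<bar> \<le> C"
    by (auto simp: Bseq_def)
  have f_le: "f n \<le> C * real (n + 2) ^ j" for n
    using abs_le_D1[OF quotient_bounded[of n]] by (simp add: pos_divide_le_eq)
  obtain K where C_less: "C < 2 ^ K" using real_arch_pow[of 2 C] by auto
  have "f n \<le> real ((n + 2) ^ (K + j))" for n
  proof -
    have "C \<le> real (n + 2) ^ K" using C_less power_mono[of 2 "real (n + 2)" K] by simp
    then have "C * real (n + 2) ^ j \<le> real (n + 2) ^ K * real (n + 2) ^ j"
      by (intro mult_right_mono) auto
    also have "\<dots> = real ((n + 2) ^ (K + j))" by (simp add: power_add)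
    finally show ?thesis using f_le[of n] by linarith
  qed
  then show ?thesis by blast
qed

lemma bigo_below_power_if_dominated:
  assumes below: "strictly_below_power f c" "\<forall>\<^sub>F n in sequentially. f n \<ge> 0" and "c > 2" "p > 0"
    and dominated: "\<And>n. n \<ge> 1 \<Longrightarrow> 0 \<le> g n"
      "\<And>n. n \<ge> 1 \<Longrightarrow> g n \<le> C * (f (p * n + q) + real n ^ 2)"
  shows "\<exists>\<epsilon>>0. g \<in> O(\<lambda>n. real n powr (c - \<epsilon>))"
proof -
  obtain \<epsilon> where exponent: "0 < \<epsilon>" "\<epsilon> \<le> c - 2" "f \<in> O(\<lambda>n. real n powr (c - \<epsilon>))"
    using strictly_below_power_bigo[OF below, of "c - 2"] \<open>c > 2\<close> by auto
  have "\<forall>\<^sub>F n in sequentially. norm (g n) \<le> norm (C * (f (p * n + q) + real n ^ 2))"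
    using eventually_ge_at_top[of 1]
  proof eventually_elim
    case (elim n)
    with dominated[of n] show ?case by simp
  qed
  then have "g \<in> O(\<lambda>n. C * (f (p * n + q) + real n ^ 2))" by (rule landau_o.big_mono)
  moreover have "(\<lambda>n. f (p * n + q)) \<in> O(\<lambda>n. real n powr (c - \<epsilon>))"
    using exponent \<open>p > 0\<close> by (intro bigo_powr_reindex_affine) auto
  moreover have "(\<lambda>n. real n ^ 2) \<in> O(\<lambda>n. real n powr (c - \<epsilon>))"
    using bigo_powr_mono[of 2 "c - \<epsilon>"] exponent(2) by simp
  ultimately have "g \<in> O(\<lambda>n. real n powr (c - \<epsilon>))"
    by (elim landau_o.big_trans) (simp add: sum_in_bigo)
  with exponent(1) show ?thesis by blast
qed

lemma round_time_nonneg: "U \<ge> 0 \<Longrightarrow> Q \<ge> 0 \<Longrightarrow> 0 \<le> round_time n U Q"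
  by (simp add: round_time_def)

lemma prep_overhead_nonneg: "U \<ge> 0 \<Longrightarrow> 0 \<le> prep_overhead n U"
  by (simp add: prep_overhead_def)

lemma total_round_time_le:
  assumes "n \<ge> 1" "U \<ge> 0" "Q \<ge> 0"
  shows "n * round_time n U Q \<le>
    76 * (real (3 * n + 1) ^ 2 * U + real (3 * n + 1) * Q + real n ^ 2)"
proof -
  define N where "N = real (3 * n + 1)"
  have "n * round_time n U Q = 6 * (real n ^ 2 * U) + real n * Q + 66 * real n ^ 2 + 10 * real n"
    by (simp add: round_time_def power2_eq_square algebra_simps)
  moreover have "real n ^ 2 * U \<le> N ^ 2 * U" "real n * Q \<le> N * Q"
    using assms by (auto simp: N_def intro!: mult_right_mono power_mono)
  moreover have "real n \<le> real n ^ 2" using assms(1) by (simp add: power2_eq_square)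
  moreover have "0 \<le> real n ^ 2 * U" "0 \<le> real n * Q" using assms by auto
  ultimately show ?thesis
    unfolding N_def[symmetric] by (smt (verit))
qed

lemma prep_overhead_le:
  assumes "n \<ge> 1" "U \<ge> 0" "Q \<ge> 0"
  shows "prep_overhead n U \<le>
    111 * (real (3 * n + 1) ^ 2 * U + real (3 * n + 1) * Q + real n ^ 2)"
proof -
  define N where "N = real (3 * n + 1)"
  have "prep_overhead n U = real n ^ 2 * U + 80 * real n ^ 2 + 14 * real n + 17"
    by (simp add: prep_overhead_def prediction_length_def power2_eq_square algebra_simps)
  moreover have "real n ^ 2 * U \<le> N ^ 2 * U"
    using assms by (auto simp: N_def intro!: mult_right_mono power_mono)
  moreover have "1 \<le> real n" "real n \<le> real n ^ 2" using assms(1) by (auto simp: power2_eq_square)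
  moreover have "0 \<le> real n ^ 2 * U" "0 \<le> N * Q" using assms by (simp_all add: N_def)
  ultimately show ?thesis
    unfolding N_def[symmetric] by (smt (verit))
qed

lemma reduction_word_size:
  assumes "(\<lambda>n. prep_overhead n (U (3 * n + 1))) \<in> O(\<lambda>n. real n powr (3 - \<epsilon>))" "\<epsilon> > 0"
    and "\<And>n. n \<ge> 1 \<Longrightarrow> U (3 * n + 1) \<ge> 0"
  shows "\<exists>K. \<forall>n\<ge>1. dyn_input_size n ^ k \<le> (n + 2) ^ K \<and> dyn_input_size n \<le> (n + 2) ^ K \<and>
    real (dyn_input_size n ^ k) + prep_overhead n (U (3 * n + 1)) \<le> real ((n + 2) ^ K)"
proof -
  have "(\<lambda>n. real n powr (3 - \<epsilon>)) \<in> O(\<lambda>n. real n ^ 3)"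
    using bigo_powr_mono[of "3 - \<epsilon>" 3] \<open>\<epsilon> > 0\<close> by simp
  note prep = landau_o.big_trans[OF assms(1) this]
  have mono: "(\<lambda>n. real n ^ i) \<in> O(\<lambda>n. real n ^ j)" if "i \<le> j" for i j
    using that by (intro landau_o.big_power_increasing) (auto intro!: bigoI[of _ 1])
  have size: "(\<lambda>n. real (dyn_input_size n)) \<in> O(\<lambda>n. real n ^ 2)"
    unfolding dyn_input_size_def prediction_length_def by real_asymp
  have "(\<lambda>n. real (dyn_input_size n ^ k)) \<in> O(\<lambda>n. real n ^ (2 * k))"
    using landau_o.big_power[OF size, of k] by (simp add: power_mult)
  with prep size have "(\<lambda>n. real (dyn_input_size n ^ k) + real (dyn_input_size n) +
      prep_overhead n (U (3 * n + 1))) \<in> O(\<lambda>n. real n ^ (2 * k + 3))"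
    by (intro sum_in_bigo; elim landau_o.big_trans) (auto intro: mono)
  from bigo_power_imp_le_power[OF this] obtain K where
    bound: "\<And>n. real (dyn_input_size n ^ k) + real (dyn_input_size n) +
      prep_overhead n (U (3 * n + 1)) \<le> real ((n + 2) ^ K)" by blast
  have "dyn_input_size n ^ k \<le> (n + 2) ^ K \<and> dyn_input_size n \<le> (n + 2) ^ K \<and>
    real (dyn_input_size n ^ k) + prep_overhead n (U (3 * n + 1)) \<le> real ((n + 2) ^ K)"
    if n: "n \<ge> 1" for n
    using bound[of n] prep_overhead_nonneg[OF assms(3)[OF n], of n] by linarith
  then show ?thesis by blast
qed

lemma reduction_solves_oumv:
  assumes solves: "solves_s_triangle_delayed A (\<lambda>n. 2 * n) U Q"
    and prep: "(\<lambda>n. prep_overhead n (U (3 * n + 1))) \<in> O(\<lambda>n. real n powr (3 - \<epsilon>))" "\<epsilon> > 0"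
  shows "solves_oumv (reduction A) (\<lambda>n. n * round_time n (U (3 * n + 1)) (Q (3 * n + 1)))"
proof -
  obtain k where solved: "\<And>n s \<rho>' \<rho>. s < n \<Longrightarrow> \<forall>r\<in>set \<rho>'. valid_request n r \<Longrightarrow>
      delayed_for (2 * n) \<rho>' {\<rho>} \<Longrightarrow>
      solves_instance A ((n + length \<rho>' + 2) ^ k) (U n) (Q n) n s \<rho>' \<rho>"
    using solves unfolding solves_s_triangle_delayed_iff by blast
  have U_nonneg: "U (3 * n + 1) \<ge> 0" if "n \<ge> 1" for n
    using solves_s_triangle_delayed_nonneg(1)[OF solves, of "3 * n + 1"] that by simp
  obtain K where word_size: "\<And>n. n \<ge> 1 \<Longrightarrow> dyn_input_size n ^ k \<le> (n + 2) ^ K"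
    "\<And>n. n \<ge> 1 \<Longrightarrow> dyn_input_size n \<le> (n + 2) ^ K"
    "\<And>n. n \<ge> 1 \<Longrightarrow>
      real (dyn_input_size n ^ k) + prep_overhead n (U (3 * n + 1)) \<le> real ((n + 2) ^ K)"
    using reduction_word_size[OF prep U_nonneg] by blast
  show ?thesis
    unfolding solves_oumv_def
  proof (intro exI[of _ K] allI impI)
    fix n :: nat and M and uvs :: "(bool_vec \<times> bool_vec) list"
    assume n: "n \<ge> 1" and len: "length uvs = n"
    have "delayed_for (2 * (3 * n + 1)) (prediction n M) {requests n M uvs}"
      by (rule prediction_delayed_for_requests[OF len]) simp
    then have "solves_instance A (dyn_input_size n ^ k) (U (3 * n + 1)) (Q (3 * n + 1))
        (3 * n + 1) (3 * n) (prediction n M) (requests n M uvs)"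
      using solved[of "3 * n" "3 * n + 1" "prediction n M"] valid_prediction
      by (simp add: dyn_input_size_def length_prediction)
    note reduction_solves_instance[OF this U_nonneg[OF n] word_size[OF n]]
    then show "(\<forall>\<omega>. \<exists>p t as. oumv_run (reduction A) ((n + 2) ^ K) n M uvs \<omega> p t as \<and>
          p \<le> (n + 2) ^ K \<and> real t \<le> n * round_time n (U (3 * n + 1)) (Q (3 * n + 1))) \<and>
        2 / 3 \<le> measure fair_coins {\<omega>. \<exists>p t. oumv_run (reduction A) ((n + 2) ^ K) n M uvs \<omega> p t
          (map (\<lambda>(u, v). of_bool (uMv n M u v)) uvs)}"
      unfolding len by blast
  qed
qed

theorem theorem6p14:
  assumes "OuMv_conjecture"
  shows "\<exists>d :: nat \<Rightarrow> nat. (\<lambda>n. real (d n)) \<in> O(\<lambda>n. real n) \<and>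
    \<not> (\<exists>A U Q. solves_s_triangle_delayed A d U Q \<and>
         strictly_below_power (\<lambda>n. real n ^ 2 * U n + real n * Q n) 3)"
proof (intro exI[of _ "\<lambda>n. 2 * n"] conjI notI)
  show "(\<lambda>n. real (2 * n)) \<in> O(\<lambda>n. real n)" by simp
  assume "\<exists>A U Q. solves_s_triangle_delayed A (\<lambda>n. 2 * n) U Q \<and>
    strictly_below_power (\<lambda>n. real n ^ 2 * U n + real n * Q n) 3"
  then obtain A U Q where solves: "solves_s_triangle_delayed A (\<lambda>n. 2 * n) U Q"
    and below: "strictly_below_power (\<lambda>n. real n ^ 2 * U n + real n * Q n) 3" by blast
  note nonneg = solves_s_triangle_delayed_nonneg[OF solves]
  have "\<forall>\<^sub>F n in sequentially. real n ^ 2 * U n + real n * Q n \<ge> 0"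
    using eventually_ge_at_top[of 2] by eventually_elim (simp add: nonneg)
  note dominated = bigo_below_power_if_dominated[OF below this, of 3]
  obtain \<epsilon> where "\<epsilon> > 0"
    "(\<lambda>n. n * round_time n (U (3 * n + 1)) (Q (3 * n + 1))) \<in> O(\<lambda>n. real n powr (3 - \<epsilon>))"
    using dominated[OF _ _ _ total_round_time_le] round_time_nonneg nonneg by auto
  moreover obtain \<delta> where
    "\<delta> > 0" "(\<lambda>n. prep_overhead n (U (3 * n + 1))) \<in> O(\<lambda>n. real n powr (3 - \<delta>))"
    using dominated[OF _ _ prep_overhead_nonneg prep_overhead_le] nonneg by auto
  ultimately show False
    using assms reduction_solves_oumv[OF solves] unfolding OuMv_conjecture_def by blast
qed

end
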